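(* Consider hyperbolic IFSs $\widetilde\Phi=\{g_0,g_1\}\subseteq C^s([0,1])$, $s\ge 1$, satisfying the Livsic condition: there exists $0<\lambda<1/2$ such that $G_w'(y_w)=\lambda^{|w|}$ for all finite words $w\in\{0,1\}^*$. Then: 1. For $s=1$, there exists such a $\widetilde\Phi$ (of class $C^1$ and satisfying the Livsic condition) that is not $C^1$-conjugate to any pseudo-affine IFS. 2. If $s>1$, then every such $\widetilde\Phi$ is $C^s$-conjugate to a pseudo-affine IFS of class $C^s$ with slope $\lambda$.
   Context: Regularity. For an integer $r\ge 1$ and $0<\alpha\le 1$, a map $g:[0,1]\to\mathbb{R}$ is of class $C^{r,\alpha}$ if its derivatives up to order $r$ exist and are continuous and the $r$-th derivative is $\alpha$-Hölder (Lipschitz if $\alpha=1$). The regularity index $s$ ranges in $[1,\infty)\cup\{\infty\}$: for real $s>1$, "class $C^s$" means class $C^{r,\alpha}$ where $s=r+\alpha$, $r\ge 1$ an integer, $0<\alpha\le 1$; for $s=1$ it means continuously differentiable; for $s=\infty$ it means smooth. A $C^s$ diffeomorphism is a bijection that is $C^s$ together with its inverse. IFS. A hyperbolic IFS of class $C^s$ is a pair $\{g_0,g_1\}\subset C^s([0,1])$ of maps of $[0,1]$ into itself with $0<\inf_{t\in[0,1]}|g_i'(t)|\le\sup_{t\in[0,1]}|g_i'(t)|<1$ for $i=0,1$ and $0=g_0(0)<g_0(1)<g_1(0)<g_1(1)=1$. For a (nonempty) finite word $w=w_1\cdots w_n\in\{0,1\}^*$, $|w|=n$, $G_w=g_{w_1}\circ\cdots\circ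 g_{w_n}$, and $y_w$ is the unique fixed point of $G_w$. The attractor $X_\Phi$ of an IFS $\Phi=\{f_0,f_1\}$ is the unique nonempty compact set $X\subseteq[0,1]$ with $X=f_0(X)\cup f_1(X)$. An IFS $\Phi\subseteq C^1([0,1])$ (of non-singular strict contractions of $[0,1]$) is pseudo-affine with slope $\lambda$ if $f'(x)=\lambda$ for all $x\in X_\Phi$ and all $f\in\Phi$, and pseudo-affine if this holds for some $\lambda$. $\widetilde\Phi$ is $C^s$-conjugate to $\Phi$ if there is a $C^s$ diffeomorphism $h$ of $[0,1]$ with $\Phi=\{h\circ g_i\circ h^{-1}\}_{i=0,1}$. *)

theory Defs
  imports "HOL-Analysis.Analysis"
begin

text \<open>
  Maps \<open>[0,1] \<rightarrow> \<real>\<close> are represented by functions \<open>real \<Rightarrow> real\<close> of which only the values on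
  \<open>{0..1}\<close> matter; derivatives are therefore taken within \<open>{0..1}\<close>, i.e. they are
  one-sided at the endpoints.
\<close>

definition deriv01 :: "(real \<Rightarrow> real) \<Rightarrow> real \<Rightarrow> real" where
  "deriv01 g x = vector_derivative g (at x within {0..1})"

definition C_int :: "nat \<Rightarrow> (real \<Rightarrow> real) \<Rightarrow> bool" where
  "C_int r g \<longleftrightarrow>
     (\<forall>k<r. \<forall>x\<in>{0..1}. ((deriv01 ^^ k) g) differentiable (at x within {0..1})) \<and>
     (\<forall>k\<le>r. continuous_on {0..1} ((deriv01 ^^ k) g))"

definition holder01 :: "real \<Rightarrow> (real \<Rightarrow> real) \<Rightarrow> bool" where
  "holder01 \<alpha> u \<longleftrightarrow>
     (\<exists>C. \<forall>x\<in>{0..1}. \<forall>y\<in>{0..1}. \<bar>u x - u y\<bar> \<le> C * \<bar>x - y\<bar> powr \<alpha>)"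

definition C_holder :: "nat \<Rightarrow> real \<Rightarrow> (real \<Rightarrow> real) \<Rightarrow> bool" where
  "C_holder r \<alpha> g \<longleftrightarrow> C_int r g \<and> holder01 \<alpha> ((deriv01 ^^ r) g)"

text \<open>
  The class \<open>C\<^sup>s\<close> for \<open>s \<in> [1,\<infinity>) \<union> {\<infinity>}\<close>. For an integer \<open>s > 1\<close> this is
  \<open>C\<close> of order \<open>(s - 1, 1)\<close>, with Lipschitz last derivative, and not \<open>s\<close>-fold continuous
  differentiability. No function is of class \<open>C\<^sup>s\<close> for \<open>s < 1\<close>.
\<close>

definition C_class :: "ereal \<Rightarrow> (real \<Rightarrow> real) \<Rightarrow> bool" where
  "C_class s g \<longleftrightarrow>
     (s = 1 \<and> C_int 1 g) \<or>
     (s = \<infinity> \<and> (\<forall>r. C_int r g)) \<or>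
     (\<exists>r \<alpha>. 1 \<le> r \<and> 0 < \<alpha> \<and> \<alpha> \<le> 1 \<and> s = ereal (real r + \<alpha>) \<and> C_holder r \<alpha> g)"

definition C_diffeo :: "ereal \<Rightarrow> (real \<Rightarrow> real) \<Rightarrow> bool" where
  "C_diffeo s h \<longleftrightarrow>
     bij_betw h {0..1} {0..1} \<and> C_class s h \<and> C_class s (inv_into {0..1} h)"

text \<open>
  An IFS \<open>{g\<^sub>0, g\<^sub>1}\<close> is a family indexed by \<open>bool\<close>, with \<open>False\<close> for \<open>0\<close> and
  \<open>True\<close> for \<open>1\<close>.
\<close>

type_synonym ifs = "bool \<Rightarrow> real \<Rightarrow> real"

definition hyperbolic_ifs :: "ereal \<Rightarrow> ifs \<Rightarrow> bool" where
  "hyperbolic_ifs s g \<longleftrightarrow>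
     (\<forall>i. C_class s (g i) \<and> g i ` {0..1} \<subseteq> {0..1} \<and>
          0 < (INF t\<in>{0..1}. \<bar>deriv01 (g i) t\<bar>) \<and>
          (SUP t\<in>{0..1}. \<bar>deriv01 (g i) t\<bar>) < 1) \<and>
     0 = g False 0 \<and> g False 0 < g False 1 \<and> g False 1 < g True 0 \<and>
     g True 0 < g True 1 \<and> g True 1 = 1"

definition word_map :: "ifs \<Rightarrow> bool list \<Rightarrow> real \<Rightarrow> real" where
  "word_map g w = foldr (\<lambda>i F. g i \<circ> F) w id"

definition word_fix :: "ifs \<Rightarrow> bool list \<Rightarrow> real" where
  "word_fix g w = (THE y. y \<in> {0..1} \<and> word_map g w y = y)"

definition livsic :: "real \<Rightarrow> ifs \<Rightarrow> bool" where
  "livsic l g \<longleftrightarrow>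
     (\<forall>w. w \<noteq> [] \<longrightarrow> deriv01 (word_map g w) (word_fix g w) = l ^ length w)"

definition attractor :: "ifs \<Rightarrow> real set" where
  "attractor f =
     (THE X. X \<noteq> {} \<and> compact X \<and> X \<subseteq> {0..1} \<and> X = f False ` X \<union> f True ` X)"

text \<open>An IFS of non-singular strict contractions; no position of the images is prescribed.\<close>

definition contractive_ifs :: "ifs \<Rightarrow> bool" where
  "contractive_ifs f \<longleftrightarrow>
     (\<forall>i. C_class 1 (f i) \<and> f i ` {0..1} \<subseteq> {0..1} \<and>
          (\<forall>x\<in>{0..1}. deriv01 (f i) x \<noteq> 0) \<and>
          (\<exists>c<1. c-lipschitz_on {0..1} (f i)))"

definition pseudo_affine_slope :: "real \<Rightarrow> ifs \<Rightarrow> bool" where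
  "pseudo_affine_slope l f \<longleftrightarrow>
     contractive_ifs f \<and> (\<forall>x\<in>attractor f. \<forall>i. deriv01 (f i) x = l)"

definition pseudo_affine :: "ifs \<Rightarrow> bool" where
  "pseudo_affine f \<longleftrightarrow> (\<exists>l. pseudo_affine_slope l f)"

text \<open>
  Conjugacy compares the two IFSs as sets of maps of \<open>[0,1]\<close>, so the labels may be exchanged
  (as happens for a decreasing conjugacy).
\<close>

definition C_conjugate :: "ereal \<Rightarrow> ifs \<Rightarrow> ifs \<Rightarrow> bool" where
  "C_conjugate s g f \<longleftrightarrow>
     (\<exists>h. C_diffeo s h \<and>
        range (\<lambda>i. restrict (f i) {0..1}) =
        range (\<lambda>i. restrict (h \<circ> g i \<circ> inv_into {0..1} h) {0..1}))"

end

theory Submission imports Defs begin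

text \<open>
  \<^bold>\<open>The case \<open>s > 1\<close>.\<close> A conjugacy \<open>h\<close> to a pseudo-affine IFS of slope \<open>l\<close> is a diffeomorphism
  whose density \<open>\<rho> = h'\<close> satisfies \<open>\<rho> (g\<^sub>i x) g\<^sub>i' x = l \<rho> x\<close> on the attractor. For the first map alone
  the equation is solved on all of \<open>[0,1]\<close> by the linearisation of \<open>g\<^sub>0\<close> at its fixed point \<open>0\<close>
  (Koenigs, Sternberg): \<open>ln \<rho>\<close> is the sum of \<open>ln (g\<^sub>0' / l)\<close> along forward orbits, and it is as regular
  as \<open>g\<^sub>0'\<close> because its derivatives solve equations \<open>v = \<psi> + a \<cdot> (v \<circ> g\<^sub>0)\<close> with \<open>\<bar>a\<bar> \<le> 1\<close> (lemmas
  \<open>CH_solution\<close> and \<open>koenigs_density\<close>). The periodic points of the words \<open>0\<^sup>n w\<close> tend to \<open>0\<close>, and the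
  Livsic condition at these points shows in the limit that \<open>\<rho>\<close> also solves the equation for \<open>g\<^sub>1\<close> at the
  points \<open>G\<^sub>w 0\<close>, which are dense in the attractor (lemma \<open>livsic_balanced\<close>). Off the attractor the
  conjugated maps need not contract yet. On the images \<open>G\<^sub>w [0,1]\<close> of words \<open>w\<close> of a large length \<open>n\<close> they
  contract by a factor \<open>\<mu> < 1/2\<close>, and replacing \<open>h\<close> by the sum of \<open>h \<circ> G\<^sub>w\<close> over these words gives maps
  that contract everywhere by the factor \<open>2 \<mu> < 1\<close>, while on the attractor the density is only multiplied
  by \<open>(2 l)\<^sup>n\<close> (lemma \<open>contracted_density\<close>).

  \<^bold>\<open>The case \<open>s = 1\<close>.\<close> Coboundaries of continuous functions are not uniformly closed. Let \<open>A\<^sub>0, A\<^sub>1\<close> be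
  the affine maps of ratio \<open>1/4\<close> fixing \<open>0\<close> and \<open>1\<close>. Functions \<open>u\<^sub>j \<le> 0\<close> are constructed that change by
  at most a constant under \<open>A\<^sub>0\<close> and \<open>A\<^sub>1\<close>, vanish at \<open>1\<close>, and have \<open>u\<^sub>j 0\<close> of order \<open>-4\<^sup>j\<close>. With
  \<open>U = \<Sum>\<^sub>j 2\<^sup>-\<^sup>j\<^sup>-\<^sup>2 u\<^sub>j\<close>, the increments \<open>U (A\<^sub>i x) - U x\<close> are uniformly convergent sums, hence
  continuous, whereas \<open>U\<close> is \<open>-\<infinity>\<close> at \<open>0\<close> and unbounded near \<open>0\<close>. The primitive of the density \<open>e\<^sup>U \<le> 1\<close> is a homeomorphism
  that is not a diffeomorphism, yet it transports \<open>A\<^sub>0, A\<^sub>1\<close> to \<open>C\<^sup>1\<close> maps, with derivatives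
  \<open>exp (U (A\<^sub>i x) - U x) / 4\<close> (lemma \<open>warped_has_deriv\<close>). Along periodic orbits the partial sums cancel,
  which gives the Livsic condition (\<open>livsic_warped\<close>), while along the orbit of \<open>1\<close> under \<open>A\<^sub>0\<close> the products
  \<open>exp (U (4\<^sup>-\<^sup>n) - U 1)\<close> are not bounded away from \<open>0\<close>, which excludes a \<open>C\<^sup>1\<close> conjugacy to a pseudo-affine
  IFS (\<open>warped_not_conjugate\<close>).
\<close>

section \<open>Derivatives on the unit interval\<close>

text \<open>
  \<open>f'\<close> is the derivative of \<open>f\<close> on \<open>[0,1]\<close>, one-sided at the endpoints.
\<close>

abbreviation deriv_on01 :: "(real \<Rightarrow> real) \<Rightarrow> (real \<Rightarrow> real) \<Rightarrow> bool" where
  "deriv_on01 f f' \<equiv> \<forall>x\<in>{0..1}. (f has_real_derivative f' x) (at x within {0..1})"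

lemma deriv01_eq:
  assumes "(f has_real_derivative d) (at x within {0..1})" "x \<in> {0..1}"
  shows "deriv01 f x = d"
  unfolding deriv01_def
  using assms vector_derivative_within_cbox[of 0 1 x f d]
  by (simp add: has_real_derivative_iff_has_vector_derivative)

lemma deriv01_works:
  assumes "f differentiable (at x within {0..1})" "x \<in> {0..1}"
  shows "(f has_real_derivative deriv01 f x) (at x within {0..1})"
  using assms(1) deriv01_eq[OF _ assms(2), of f]
  by (metis real_differentiable_def)

lemma deriv_on01_unique:
  assumes "deriv_on01 f a" "deriv_on01 f b" "x \<in> {0..1}"
  shows "a x = b x"
  using assms deriv01_eq by metis

lemma deriv_on01_cong:
  assumes "deriv_on01 f f'" "\<And>x. x \<in> {0..1} \<Longrightarrow> f x = k x" "\<And>x. x \<in> {0..1} \<Longrightarrow> f' x = k' x"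
  shows "deriv_on01 k k'"
proof
  fix x :: real assume x: "x \<in> {0..1}"
  show "(k has_real_derivative k' x) (at x within {0..1})"
    by (rule has_field_derivative_transform_within[of f _ x _ 1]) (use assms x in auto)
qed

lemma deriv_on01_cont: "deriv_on01 f f' \<Longrightarrow> continuous_on {0..1} f"
  by (metis DERIV_continuous_on)

lemma deriv_on01_comp:
  assumes "deriv_on01 f f'" "deriv_on01 g g'" "\<And>x. x \<in> {0..1} \<Longrightarrow> g x \<in> {0..1}"
  shows "deriv_on01 (\<lambda>x. f (g x)) (\<lambda>x. f' (g x) * g' x)"
proof
  fix x :: real assume x: "x \<in> {0..1}"
  have "(f has_real_derivative f' (g x)) (at (g x) within g ` {0..1})"
    by (rule DERIV_subset[of _ _ _ "{0..1}"]) (use assms x in auto)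
  then show "((\<lambda>x. f (g x)) has_real_derivative f' (g x) * g' x) (at x within {0..1})"
    using DERIV_image_chain[of f "f' (g x)" g x "{0..1}" "g' x"] assms(2) x by (auto simp: o_def)
qed

lemma deriv_on01_lipschitz:
  assumes "deriv_on01 f f'" "\<And>x. x \<in> {0..1} \<Longrightarrow> \<bar>f' x\<bar> \<le> B" "x \<in> {0..1}" "y \<in> {0..1}"
  shows "\<bar>f x - f y\<bar> \<le> B * \<bar>x - y\<bar>"
  using field_differentiable_bound[of "{0..1}" f f' B x y] assms by (auto simp: norm_real)

lemma bounded_on01:
  fixes f :: "real \<Rightarrow> real"
  assumes "continuous_on {0..1} f"
  obtains B where "B > 0" "\<And>x. x \<in> {0..1} \<Longrightarrow> \<bar>f x\<bar> \<le> B"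
proof -
  have "bounded (f ` {0..1})"
    by (intro compact_imp_bounded compact_continuous_image assms) simp
  then show ?thesis using that unfolding bounded_pos by (auto simp: norm_real)
qed

lemma pos_lower_bound01:
  fixes f :: "real \<Rightarrow> real"
  assumes "continuous_on {0..1} f" "\<And>x. x \<in> {0..1} \<Longrightarrow> 0 < f x"
  obtains b where "b > 0" "\<And>x. x \<in> {0..1} \<Longrightarrow> b \<le> f x"
proof -
  obtain x where "x \<in> {0..1}" "\<forall>y\<in>{0..1}. f x \<le> f y"
    using continuous_attains_inf[OF _ _ assms(1)] by auto
  then show ?thesis using that[of "f x"] assms(2) by auto
qed

lemma differentiable_on01_iff:
  "(\<forall>x\<in>{0..1}. f differentiable (at x within {0..1})) \<longleftrightarrow> deriv_on01 f (deriv01 f)"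
proof (intro iffI ballI)
  fix x :: real assume "deriv_on01 f (deriv01 f)" "x \<in> {0..1}"
  then have "(f has_real_derivative deriv01 f x) (at x within {0..1})" by (rule bspec)
  then show "f differentiable (at x within {0..1})" by (rule real_differentiable_def[THEN iffD2, OF exI])
next
  fix x :: real assume "\<forall>x\<in>{0..1}. f differentiable (at x within {0..1})" "x \<in> {0..1}"
  then have "f differentiable (at x within {0..1})" by (rule bspec)
  then show "(f has_real_derivative deriv01 f x) (at x within {0..1})"
    using \<open>x \<in> {0..1}\<close> by (rule deriv01_works)
qed

lemma C_int_Suc:
  "C_int (Suc r) f \<longleftrightarrow> deriv_on01 f (deriv01 f) \<and> C_int r (deriv01 f)"
proof -
  have shift: "(deriv01 ^^ Suc k) f = (deriv01 ^^ k) (deriv01 f)" for k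
    by (simp only: funpow_Suc_right o_apply)
  define P where "P u \<longleftrightarrow> (\<forall>x\<in>{0..1}. u differentiable (at x within {0..1}))" for u :: "real \<Rightarrow> real"
  have C: "C_int n u \<longleftrightarrow> (\<forall>k<n. P ((deriv01 ^^ k) u)) \<and> (\<forall>k<Suc n. continuous_on {0..1} ((deriv01 ^^ k) u))"
    for n u by (simp only: C_int_def P_def less_Suc_eq_le)
  have "C_int (Suc r) f \<longleftrightarrow> P f \<and> continuous_on {0..1} f \<and> C_int r (deriv01 f)"
    unfolding C All_less_Suc2[of "Suc r"] All_less_Suc2[of r "\<lambda>k. P ((deriv01 ^^ k) f)"] shift funpow_0
    by (simp only: conj_ac)
  moreover have "P f \<longleftrightarrow> deriv_on01 f (deriv01 f)"
    unfolding P_def by (rule differentiable_on01_iff)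
  moreover have "P f \<longrightarrow> continuous_on {0..1} f"
    unfolding P_def by (simp add: differentiable_imp_continuous_on differentiable_on_def)
  ultimately show ?thesis by argo
qed

section \<open>Hoelder classes under algebraic operations, composition and inversion\<close>

text \<open>
  The class \<open>C\<close> of order \<open>(m, \<alpha>)\<close>, by recursion on \<open>m\<close> with an existentially quantified
  derivative: in contrast to iterating the function \<open>deriv01\<close>, this form is visibly stable under
  the algebraic operations.
\<close>

primrec CH :: "real \<Rightarrow> nat \<Rightarrow> (real \<Rightarrow> real) \<Rightarrow> bool" where
  "CH \<alpha> 0 f = holder01 \<alpha> f"
| "CH \<alpha> (Suc m) f = (\<exists>f'. deriv_on01 f f' \<and> CH \<alpha> m f')"

lemma CH_SucI: "deriv_on01 f f' \<Longrightarrow> CH \<alpha> m f' \<Longrightarrow> CH \<alpha> (Suc m) f"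
  by auto

lemma CH_cong:
  assumes "CH \<alpha> m f" "\<And>x. x \<in> {0..1} \<Longrightarrow> f x = k x"
  shows "CH \<alpha> m k"
proof (cases m)
  case 0
  then show ?thesis using assms by (auto simp: holder01_def)
next
  case (Suc n)
  then obtain f' where f': "deriv_on01 f f'" "CH \<alpha> n f'" using assms by auto
  have "deriv_on01 k f'" by (rule deriv_on01_cong[OF f'(1) assms(2)]) auto
  then show ?thesis using Suc f'(2) by auto
qed

lemma CH_Suc_iff:
  assumes "deriv_on01 f f'"
  shows "CH \<alpha> (Suc m) f \<longleftrightarrow> CH \<alpha> m f'"
proof
  assume "CH \<alpha> (Suc m) f"
  then obtain f1 where f1: "deriv_on01 f f1" "CH \<alpha> m f1" by auto
  show "CH \<alpha> m f'"
    by (rule CH_cong[OF f1(2)]) (use deriv_on01_unique[OF f1(1) assms] in auto)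
qed (use assms in auto)

lemma holder01_bound:
  assumes "holder01 \<alpha> f"
  obtains C where "C \<ge> 0" "\<And>x y. x \<in> {0..1} \<Longrightarrow> y \<in> {0..1} \<Longrightarrow> \<bar>f x - f y\<bar> \<le> C * \<bar>x - y\<bar> powr \<alpha>"
proof -
  obtain C where C: "\<forall>x\<in>{0..1}. \<forall>y\<in>{0..1}. \<bar>f x - f y\<bar> \<le> C * \<bar>x - y\<bar> powr \<alpha>"
    using assms unfolding holder01_def by blast
  have "\<bar>f 0 - f 1\<bar> \<le> C * \<bar>0 - 1\<bar> powr \<alpha>" by (rule C[THEN bspec, THEN bspec]) auto
  then have "0 \<le> C" by simp
  then show ?thesis using that C by blast
qed

lemma holder01_cont:
  assumes "0 < \<alpha>" "holder01 \<alpha> f"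
  shows "continuous_on {0..1} f"
proof -
  obtain C where C: "\<And>x y. x \<in> {0..1} \<Longrightarrow> y \<in> {0..1} \<Longrightarrow> \<bar>f x - f y\<bar> \<le> C * \<bar>x - y\<bar> powr \<alpha>"
    using holder01_bound[OF assms(2)] by metis
  show ?thesis unfolding continuous_on_def
  proof
    fix x :: real assume x: "x \<in> {0..1}"
    have "((\<lambda>y. C * \<bar>y - x\<bar> powr \<alpha>) \<longlongrightarrow> C * \<bar>x - x\<bar> powr \<alpha>) (at x within {0..1})"
      using assms(1) by (intro tendsto_intros) auto
    then have lim: "((\<lambda>y. C * \<bar>y - x\<bar> powr \<alpha>) \<longlongrightarrow> 0) (at x within {0..1})" by simp
    have "((\<lambda>y. f y - f x) \<longlongrightarrow> 0) (at x within {0..1})"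
      by (rule Lim_null_comparison[OF _ lim]) (use C x in \<open>auto simp: eventually_at_filter\<close>)
    then show "(f \<longlongrightarrow> f x) (at x within {0..1})" by (simp add: LIM_zero_iff)
  qed
qed

lemma CH_cont: "0 < \<alpha> \<Longrightarrow> CH \<alpha> m f \<Longrightarrow> continuous_on {0..1} f"
  by (cases m) (auto intro: holder01_cont deriv_on01_cont)

lemma C_holder_iff_CH: "0 < \<alpha> \<Longrightarrow> C_holder m \<alpha> f \<longleftrightarrow> CH \<alpha> m f"
proof (induction m arbitrary: f)
  case 0
  then show ?case by (auto simp: C_holder_def C_int_def holder01_cont)
next
  case (Suc m)
  have "C_holder (Suc m) \<alpha> f \<longleftrightarrow> deriv_on01 f (deriv01 f) \<and> C_holder m \<alpha> (deriv01 f)"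
    unfolding C_holder_def C_int_Suc funpow_Suc_right by auto
  also have "\<dots> \<longleftrightarrow> deriv_on01 f (deriv01 f) \<and> CH \<alpha> m (deriv01 f)" using Suc by simp
  also have "\<dots> \<longleftrightarrow> CH \<alpha> (Suc m) f"
  proof
    assume "CH \<alpha> (Suc m) f"
    then obtain f' where f': "deriv_on01 f f'" "CH \<alpha> m f'" by auto
    then have eq: "f' x = deriv01 f x" if "x \<in> {0..1}" for x
      using deriv01_eq that by metis
    show "deriv_on01 f (deriv01 f) \<and> CH \<alpha> m (deriv01 f)"
      using deriv_on01_cong[OF f'(1)] CH_cong[OF f'(2)] eq by blast
  qed auto
  finally show ?case .
qed

lemma holder01_of_lipschitz:
  assumes "0 < \<alpha>" "\<alpha> \<le> 1"
    and L: "\<And>x y. x \<in> {0..1} \<Longrightarrow> y \<in> {0..1} \<Longrightarrow> \<bar>f x - f y\<bar> \<le> L * \<bar>x - y\<bar>"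
  shows "holder01 \<alpha> f"
  unfolding holder01_def
proof (intro exI ballI)
  fix x y :: real assume xy: "x \<in> {0..1}" "y \<in> {0..1}"
  have "0 \<le> L" using L[of 0 1] by simp
  have "\<bar>x - y\<bar> \<le> \<bar>x - y\<bar> powr \<alpha>"
    using powr_mono'[of \<alpha> 1 "\<bar>x - y\<bar>"] xy assms(2) by auto
  then show "\<bar>f x - f y\<bar> \<le> L * \<bar>x - y\<bar> powr \<alpha>"
    using L[OF xy] mult_left_mono[OF _ \<open>0 \<le> L\<close>] by fastforce
qed

lemma holder01_of_deriv:
  assumes "0 < \<alpha>" "\<alpha> \<le> 1" "deriv_on01 f f'" "continuous_on {0..1} f'"
  shows "holder01 \<alpha> f"
proof -
  obtain B where "\<And>x. x \<in> {0..1} \<Longrightarrow> \<bar>f' x\<bar> \<le> B" using bounded_on01[OF assms(4)] by metis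
  then show ?thesis
    using holder01_of_lipschitz[OF assms(1,2)] deriv_on01_lipschitz[OF assms(3)] by metis
qed

lemma CH_SucD:
  assumes "0 < \<alpha>" "\<alpha> \<le> 1" "CH \<alpha> (Suc m) f"
  shows "CH \<alpha> m f"
  using assms(3)
proof (induction m arbitrary: f)
  case 0
  then show ?case using holder01_of_deriv[OF assms(1,2)] holder01_cont[OF assms(1)] by auto
next
  case (Suc m)
  then obtain f' where "deriv_on01 f f'" "CH \<alpha> (Suc m) f'" by auto
  with Suc.IH show ?case by auto
qed

lemma CH_mono:
  assumes "0 < \<alpha>" "\<alpha> \<le> 1" "m \<le> n" "CH \<alpha> n f"
  shows "CH \<alpha> m f"
  using assms(3,4) by (induction rule: inc_induct) (auto intro: CH_SucD[OF assms(1,2)] simp del: CH.simps)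

lemma CH_const: "CH \<alpha> m (\<lambda>x. c)"
proof (induction m arbitrary: c)
  case 0 show ?case by (auto simp: holder01_def intro: exI[of _ 0])
next
  case (Suc m) then show ?case by (auto intro!: exI[of _ "\<lambda>x. 0"])
qed

lemma CH_add:
  assumes "CH \<alpha> m f" "CH \<alpha> m k"
  shows "CH \<alpha> m (\<lambda>x. f x + k x)"
  using assms
proof (induction m arbitrary: f k)
  case 0
  then obtain C D where
    C: "\<And>x y. x \<in> {0..1} \<Longrightarrow> y \<in> {0..1} \<Longrightarrow> \<bar>f x - f y\<bar> \<le> C * \<bar>x - y\<bar> powr \<alpha>" and
    D: "\<And>x y. x \<in> {0..1} \<Longrightarrow> y \<in> {0..1} \<Longrightarrow> \<bar>k x - k y\<bar> \<le> D * \<bar>x - y\<bar> powr \<alpha>"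
    by (metis CH.simps(1) holder01_bound)
  show ?case unfolding CH.simps holder01_def
  proof (intro exI ballI)
    fix x y :: real assume xy: "x \<in> {0..1}" "y \<in> {0..1}"
    show "\<bar>f x + k x - (f y + k y)\<bar> \<le> (C + D) * \<bar>x - y\<bar> powr \<alpha>"
      using C[OF xy] D[OF xy] by (simp add: distrib_right)
  qed
next
  case (Suc m)
  then obtain f' k' where "deriv_on01 f f'" "CH \<alpha> m f'" "deriv_on01 k k'" "CH \<alpha> m k'" by auto
  then have "deriv_on01 (\<lambda>x. f x + k x) (\<lambda>x. f' x + k' x)" "CH \<alpha> m (\<lambda>x. f' x + k' x)"
    by (simp_all add: DERIV_add Suc.IH)
  then show ?case by (rule CH_SucI)
qed

lemma CH_mult:
  assumes "0 < \<alpha>" "\<alpha> \<le> 1" "CH \<alpha> m f" "CH \<alpha> m k"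
  shows "CH \<alpha> m (\<lambda>x. f x * k x)"
  using assms(3,4)
proof (induction m arbitrary: f k)
  case 0
  then obtain C D where
    C: "\<And>x y. x \<in> {0..1} \<Longrightarrow> y \<in> {0..1} \<Longrightarrow> \<bar>f x - f y\<bar> \<le> C * \<bar>x - y\<bar> powr \<alpha>" and
    D: "\<And>x y. x \<in> {0..1} \<Longrightarrow> y \<in> {0..1} \<Longrightarrow> \<bar>k x - k y\<bar> \<le> D * \<bar>x - y\<bar> powr \<alpha>"
    by (metis CH.simps(1) holder01_bound)
  obtain A where A: "\<And>x. x \<in> {0..1} \<Longrightarrow> \<bar>f x\<bar> \<le> A"
    using bounded_on01 CH_cont[OF assms(1) 0(1)] by metis
  obtain B where B: "\<And>x. x \<in> {0..1} \<Longrightarrow> \<bar>k x\<bar> \<le> B"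
    using bounded_on01 CH_cont[OF assms(1) 0(2)] by metis
  show ?case unfolding CH.simps holder01_def
  proof (intro exI ballI)
    fix x y :: real assume xy: "x \<in> {0..1}" "y \<in> {0..1}"
    have "f x * k x - f y * k y = f x * (k x - k y) + k y * (f x - f y)"
      by (simp add: algebra_simps)
    then have "\<bar>f x * k x - f y * k y\<bar> \<le> \<bar>f x\<bar> * \<bar>k x - k y\<bar> + \<bar>k y\<bar> * \<bar>f x - f y\<bar>"
      by (metis abs_mult abs_triangle_ineq)
    also have "\<dots> \<le> A * (D * \<bar>x - y\<bar> powr \<alpha>) + B * (C * \<bar>x - y\<bar> powr \<alpha>)"
      using A[OF xy(1)] B[OF xy(2)] C[OF xy] D[OF xy]
      by (intro add_mono mult_mono) auto
    finally show "\<bar>f x * k x - f y * k y\<bar> \<le> (A * D + B * C) * \<bar>x - y\<bar> powr \<alpha>"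
      by (simp add: algebra_simps)
  qed
next
  case (Suc m)
  then obtain f' k' where d: "deriv_on01 f f'" "CH \<alpha> m f'" "deriv_on01 k k'" "CH \<alpha> m k'" by auto
  have "CH \<alpha> m (\<lambda>x. f x * k' x + f' x * k x)"
    by (rule CH_add[OF Suc.IH[OF CH_SucD[OF assms(1,2) Suc.prems(1)] d(4)]
          Suc.IH[OF d(2) CH_SucD[OF assms(1,2) Suc.prems(2)]]])
  moreover have "deriv_on01 (\<lambda>x. f x * k x) (\<lambda>x. f x * k' x + f' x * k x)"
    using d(1,3) by (intro ballI DERIV_mult') auto
  ultimately show ?case by (rule CH_SucI[rotated])
qed

lemma CH_comp:
  assumes "0 < \<alpha>" "\<alpha> \<le> 1" "CH \<alpha> m f" "CH \<alpha> m k"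
    and maps: "\<And>x. x \<in> {0..1} \<Longrightarrow> k x \<in> {0..1}"
    and lip: "\<And>x y. x \<in> {0..1} \<Longrightarrow> y \<in> {0..1} \<Longrightarrow> \<bar>k x - k y\<bar> \<le> L * \<bar>x - y\<bar>"
  shows "CH \<alpha> m (\<lambda>x. f (k x))"
  using assms(3,4)
proof (induction m arbitrary: f)
  case 0
  then obtain C where "C \<ge> 0" and
    C: "\<And>x y. x \<in> {0..1} \<Longrightarrow> y \<in> {0..1} \<Longrightarrow> \<bar>f x - f y\<bar> \<le> C * \<bar>x - y\<bar> powr \<alpha>"
    by (metis CH.simps(1) holder01_bound)
  have "0 \<le> L" using lip[of 0 1] by simp
  show ?case unfolding CH.simps holder01_def
  proof (intro exI ballI)
    fix x y :: real assume xy: "x \<in> {0..1}" "y \<in> {0..1}"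
    have "\<bar>f (k x) - f (k y)\<bar> \<le> C * \<bar>k x - k y\<bar> powr \<alpha>" using C maps xy by blast
    also have "\<dots> \<le> C * (L * \<bar>x - y\<bar>) powr \<alpha>"
      using lip[OF xy] \<open>C \<ge> 0\<close> assms(1) by (intro mult_left_mono powr_mono2) auto
    also have "\<dots> = C * L powr \<alpha> * \<bar>x - y\<bar> powr \<alpha>"
      using \<open>0 \<le> L\<close> by (simp add: powr_mult)
    finally show "\<bar>f (k x) - f (k y)\<bar> \<le> C * L powr \<alpha> * \<bar>x - y\<bar> powr \<alpha>" .
  qed
next
  case (Suc m)
  then obtain f' k' where d: "deriv_on01 f f'" "CH \<alpha> m f'" "deriv_on01 k k'" "CH \<alpha> m k'" by auto
  have "CH \<alpha> m k" by (rule CH_SucD[OF assms(1,2) Suc.prems(2)])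
  from CH_mult[OF assms(1,2) Suc.IH[OF d(2) this] d(4)]
  have "CH \<alpha> m (\<lambda>x. f' (k x) * k' x)" .
  then show ?case using deriv_on01_comp[OF d(1,3) maps] by (rule CH_SucI[rotated])
qed

lemma holder01_comp_outer:
  assumes "holder01 \<alpha> f"
    and lip: "\<And>x y. x \<in> {0..1} \<Longrightarrow> y \<in> {0..1} \<Longrightarrow> \<bar>F (f x) - F (f y)\<bar> \<le> L * \<bar>f x - f y\<bar>"
    and "L \<ge> 0"
  shows "holder01 \<alpha> (\<lambda>x. F (f x))"
proof -
  obtain C where C: "\<And>x y. x \<in> {0..1} \<Longrightarrow> y \<in> {0..1} \<Longrightarrow> \<bar>f x - f y\<bar> \<le> C * \<bar>x - y\<bar> powr \<alpha>"
    using holder01_bound[OF assms(1)] by metis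
  show ?thesis unfolding holder01_def
  proof (intro exI ballI)
    fix x y :: real assume xy: "x \<in> {0..1}" "y \<in> {0..1}"
    show "\<bar>F (f x) - F (f y)\<bar> \<le> (L * C) * \<bar>x - y\<bar> powr \<alpha>"
      using lip[OF xy] mult_left_mono[OF C[OF xy] \<open>L \<ge> 0\<close>] by (simp add: mult.assoc)
  qed
qed

lemma CH_exp:
  assumes "0 < \<alpha>" "\<alpha> \<le> 1" "CH \<alpha> m f"
  shows "CH \<alpha> m (\<lambda>x. exp (f x))"
  using assms(3)
proof (induction m arbitrary: f)
  case 0
  obtain B where B: "\<And>x. x \<in> {0..1} \<Longrightarrow> \<bar>f x\<bar> \<le> B"
    using bounded_on01 CH_cont[OF assms(1) 0] by metis
  have "\<bar>exp a - exp b\<bar> \<le> exp B * \<bar>a - b\<bar>" if "a \<in> {-B..B}" "b \<in> {-B..B}" for a b :: real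
    using field_differentiable_bound[of "{-B..B}" exp exp "exp B" a b] that
    by (auto intro: DERIV_subset[OF DERIV_exp])
  then have "\<bar>exp (f x) - exp (f y)\<bar> \<le> exp B * \<bar>f x - f y\<bar>" if "x \<in> {0..1}" "y \<in> {0..1}" for x y
    using B[OF that(1)] B[OF that(2)] by (auto simp: abs_le_iff)
  then show ?case using 0 holder01_comp_outer[of \<alpha> f exp "exp B"] by simp
next
  case (Suc m)
  then obtain f' where d: "deriv_on01 f f'" "CH \<alpha> m f'" by auto
  have "CH \<alpha> m f" by (rule CH_SucD[OF assms(1,2) Suc.prems])
  from CH_mult[OF assms(1,2) Suc.IH[OF this] d(2)]
  have "CH \<alpha> m (\<lambda>x. exp (f x) * f' x)" .
  moreover have "deriv_on01 (\<lambda>x. exp (f x)) (\<lambda>x. exp (f x) * f' x)"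
    using d(1) by (intro ballI DERIV_chain2[OF DERIV_exp]) auto
  ultimately show ?case by (rule CH_SucI[rotated])
qed

lemma CH_inverse:
  assumes "0 < \<alpha>" "\<alpha> \<le> 1" "CH \<alpha> m f" "\<And>x. x \<in> {0..1} \<Longrightarrow> 0 < f x"
  shows "CH \<alpha> m (\<lambda>x. 1 / f x)"
  using assms(3,4)
proof (induction m)
  case 0
  obtain b where b: "b > 0" "\<And>x. x \<in> {0..1} \<Longrightarrow> b \<le> f x"
    using pos_lower_bound01 CH_cont[OF assms(1) 0(1)] 0(2) by metis
  have "\<bar>1 / f x - 1 / f y\<bar> \<le> 1 / (b * b) * \<bar>f x - f y\<bar>" if "x \<in> {0..1}" "y \<in> {0..1}" for x y
  proof -
    have p: "0 < f x" "0 < f y" using 0 that by auto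
    have "\<bar>1 / f x - 1 / f y\<bar> = 1 / (f x * f y) * \<bar>f x - f y\<bar>"
      using p by (auto simp: field_simps abs_if)
    also have "\<dots> \<le> 1 / (b * b) * \<bar>f x - f y\<bar>"
      using b(1) b(2)[OF that(1)] b(2)[OF that(2)]
      by (intro mult_right_mono divide_left_mono mult_mono mult_pos_pos) auto
    finally show ?thesis .
  qed
  then show ?case using 0 holder01_comp_outer[of \<alpha> f "\<lambda>z. 1 / z" "1 / (b * b)"] by simp
next
  case (Suc m)
  then obtain f' where d: "deriv_on01 f f'" "CH \<alpha> m f'" by auto
  have nz: "\<And>x. x \<in> {0..1} \<Longrightarrow> f x \<noteq> 0" using Suc(3) by force
  have i: "CH \<alpha> m (\<lambda>x. 1 / f x)"
    by (rule Suc.IH[OF CH_SucD[OF assms(1,2) Suc.prems(1)] Suc.prems(2)])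
  have "CH \<alpha> m (\<lambda>x. (-1) * (f' x * (1 / f x * (1 / f x))))"
    by (rule CH_mult[OF assms(1,2) CH_const CH_mult[OF assms(1,2) d(2) CH_mult[OF assms(1,2) i i]]])
  moreover have "deriv_on01 (\<lambda>x. 1 / f x) (\<lambda>x. (-1) * (f' x * (1 / f x * (1 / f x))))"
  proof
    fix x :: real assume x: "x \<in> {0..1}"
    show "((\<lambda>x. 1 / f x) has_real_derivative (-1) * (f' x * (1 / f x * (1 / f x)))) (at x within {0..1})"
      using DERIV_divide[OF DERIV_const[of 1] bspec[OF d(1) x] nz[OF x]] by simp
  qed
  ultimately show ?case by (rule CH_SucI[rotated])
qed

lemma CH_ln:
  assumes "0 < \<alpha>" "\<alpha> \<le> 1" "CH \<alpha> m f" "\<And>x. x \<in> {0..1} \<Longrightarrow> 0 < f x"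
  shows "CH \<alpha> m (\<lambda>x. ln (f x))"
proof (cases m)
  case 0
  obtain b where b: "b > 0" "\<And>x. x \<in> {0..1} \<Longrightarrow> b \<le> f x"
    using pos_lower_bound01 CH_cont[OF assms(1,3)] assms(4) by metis
  have "\<bar>ln u - ln v\<bar> \<le> 1 / b * \<bar>u - v\<bar>" if "b \<le> u" "b \<le> v" for u v :: real
  proof -
    have "(ln has_real_derivative 1 / z) (at z within {b..})" "norm (1 / z) \<le> 1 / b" if "b \<le> z" for z :: real
      using that b(1) by (auto intro!: has_field_derivative_at_within DERIV_ln_divide frac_le)
    then show ?thesis
      using field_differentiable_bound[of "{b..}" ln "\<lambda>u. 1 / u" "1 / b" u v] that by auto
  qed
  then have "\<bar>ln (f x) - ln (f y)\<bar> \<le> 1 / b * \<bar>f x - f y\<bar>" if "x \<in> {0..1}" "y \<in> {0..1}" for x y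
    using b that by auto
  then show ?thesis using 0 b assms holder01_comp_outer[of \<alpha> f ln "1 / b"] by simp
next
  case (Suc n)
  then obtain f' where d: "deriv_on01 f f'" "CH \<alpha> n f'" using assms by auto
  have "CH \<alpha> n (\<lambda>x. 1 / f x)"
    by (rule CH_inverse[OF assms(1,2) CH_SucD[OF assms(1,2) assms(3)[unfolded Suc]] assms(4)])
  then have "CH \<alpha> n (\<lambda>x. f' x * (1 / f x))" by (rule CH_mult[OF assms(1,2) d(2)])
  moreover have "deriv_on01 (\<lambda>x. ln (f x)) (\<lambda>x. f' x * (1 / f x))"
  proof
    fix x :: real assume x: "x \<in> {0..1}"
    have "((\<lambda>x. ln (f x)) has_real_derivative 1 / f x * f' x) (at x within {0..1})"
      by (rule DERIV_chain2[OF DERIV_ln_divide]) (use assms(4) d x in auto)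
    then show "((\<lambda>x. ln (f x)) has_real_derivative f' x * (1 / f x)) (at x within {0..1})"
      by (simp add: mult.commute)
  qed
  ultimately show ?thesis unfolding Suc by (rule CH_SucI[rotated])
qed

text \<open>
  The inverse \<open>k\<close> of \<open>h\<close> gains its regularity step by step from \<open>k' = 1 / (h' \<circ> k)\<close>.
\<close>

lemma CH_inv:
  assumes "0 < \<alpha>" "\<alpha> \<le> 1" "CH \<alpha> (Suc m) h" "deriv_on01 h h'"
    and pos: "\<And>x. x \<in> {0..1} \<Longrightarrow> 0 < h' x"
    and kmap: "\<And>x. x \<in> {0..1} \<Longrightarrow> k x \<in> {0..1}"
    and dk: "deriv_on01 k (\<lambda>x. 1 / h' (k x))"
  shows "CH \<alpha> (Suc m) k"
  using assms(3)
proof (induction m)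
  case 0
  then have "CH \<alpha> 0 h'" using CH_Suc_iff[OF assms(4)] by blast
  then have ch: "continuous_on {0..1} h'" by (rule CH_cont[OF assms(1)])
  have "continuous_on {0..1} (\<lambda>x. 1 / h' (k x))"
    using kmap pos by (intro continuous_intros continuous_on_compose2[OF ch] deriv_on01_cont[OF dk]) force+
  then obtain B where B: "\<And>x. x \<in> {0..1} \<Longrightarrow> \<bar>1 / h' (k x)\<bar> \<le> B"
    using bounded_on01 by metis
  have lip: "\<And>x y. x \<in> {0..1} \<Longrightarrow> y \<in> {0..1} \<Longrightarrow> \<bar>k x - k y\<bar> \<le> B * \<bar>x - y\<bar>"
    using deriv_on01_lipschitz[OF dk B] by blast
  then have "CH \<alpha> 0 k" unfolding CH.simps by (rule holder01_of_lipschitz[OF assms(1,2)])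
  then have "CH \<alpha> 0 (\<lambda>x. h' (k x))"
    using CH_comp[OF assms(1,2) \<open>CH \<alpha> 0 h'\<close> _ kmap lip] by blast
  then have "CH \<alpha> 0 (\<lambda>x. 1 / h' (k x))"
    using CH_inverse[OF assms(1,2)] pos kmap by blast
  then show ?case using dk by (rule CH_SucI[rotated])
next
  case (Suc m)
  have k: "CH \<alpha> (Suc m) k" by (rule Suc.IH[OF CH_SucD[OF assms(1,2) Suc.prems]])
  have h': "CH \<alpha> (Suc m) h'" using Suc(2) CH_Suc_iff[OF assms(4)] by blast
  have "CH \<alpha> m (\<lambda>x. 1 / h' (k x))" using k CH_Suc_iff[OF dk] by blast
  then have "continuous_on {0..1} (\<lambda>x. 1 / h' (k x))" using CH_cont assms(1) by blast
  then obtain B where B: "\<And>x. x \<in> {0..1} \<Longrightarrow> \<bar>1 / h' (k x)\<bar> \<le> B"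
    using bounded_on01 by metis
  have "CH \<alpha> (Suc m) (\<lambda>x. h' (k x))"
    using CH_comp[OF assms(1,2) h' k kmap] deriv_on01_lipschitz[OF dk B] by blast
  then have "CH \<alpha> (Suc m) (\<lambda>x. 1 / h' (k x))"
    using CH_inverse[OF assms(1,2)] pos kmap by blast
  then show ?case using dk by (rule CH_SucI[rotated])
qed

section \<open>A cohomological equation at an attracting fixed point\<close>

lemma uniform_limit_geometric:
  fixes f :: "nat \<Rightarrow> 'a \<Rightarrow> real"
  assumes "\<And>n x. x \<in> S \<Longrightarrow> \<bar>f (Suc n) x - f n x\<bar> \<le> K * \<kappa> ^ n" "0 \<le> \<kappa>" "\<kappa> < 1"
  obtains l where "uniform_limit S f l sequentially"
proof -
  have s: "summable (\<lambda>n. K * \<kappa> ^ n)" using assms(2,3) by (intro summable_mult summable_geometric) auto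
  have "uniform_limit S (\<lambda>n x. \<Sum>i<n. f (Suc i) x - f i x) (\<lambda>x. \<Sum>i. f (Suc i) x - f i x) sequentially"
    by (rule Weierstrass_m_test[OF _ s]) (use assms(1) in \<open>auto simp: norm_real\<close>)
  then have "uniform_limit S (\<lambda>n x. f 0 x + (\<Sum>i<n. f (Suc i) x - f i x))
      (\<lambda>x. f 0 x + (\<Sum>i. f (Suc i) x - f i x)) sequentially"
    by (intro uniform_limit_add uniform_limit_const)
  moreover have "f 0 x + (\<Sum>i<n. f (Suc i) x - f i x) = f n x" for n x
    using sum_lessThan_telescope[of "\<lambda>i. f i x" n] by simp
  ultimately have "uniform_limit S f (\<lambda>x. f 0 x + (\<Sum>i. f (Suc i) x - f i x)) sequentially"
    by simp
  then show ?thesis by (rule that)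
qed

text \<open>A differentiable contraction of \<open>[0,1]\<close> that fixes \<open>0\<close>.\<close>

locale contraction01 =
  fixes g g' :: "real \<Rightarrow> real" and c :: real
  assumes maps: "x \<in> {0..1} \<Longrightarrow> g x \<in> {0..1}"
    and deriv: "deriv_on01 g g'"
    and bound: "x \<in> {0..1} \<Longrightarrow> \<bar>g' x\<bar> \<le> c"
    and c_less: "c < 1"
    and g0: "g 0 = 0"
begin

lemma c_nonneg: "0 \<le> c"
  using bound[of 0] by simp

lemma lip: "x \<in> {0..1} \<Longrightarrow> y \<in> {0..1} \<Longrightarrow> \<bar>g x - g y\<bar> \<le> c * \<bar>x - y\<bar>"
  by (rule deriv_on01_lipschitz[OF deriv bound])

lemma g_le: "x \<in> {0..1} \<Longrightarrow> g x \<le> c * x"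
  using lip[of x 0] g0 by auto

lemma cont: "continuous_on {0..1} g"
  by (rule deriv_on01_cont[OF deriv])

lemma iter_maps: "x \<in> {0..1} \<Longrightarrow> (g ^^ n) x \<in> {0..1}"
  by (induction n) (simp_all add: maps del: atLeastAtMost_iff)

lemma iter_le: "x \<in> {0..1} \<Longrightarrow> (g ^^ n) x \<le> c ^ n"
proof (induction n)
  case (Suc n)
  then have "(g ^^ Suc n) x \<le> c * (g ^^ n) x" using g_le[OF iter_maps] by simp
  also have "\<dots> \<le> c * c ^ n" using Suc c_nonneg by (intro mult_left_mono) auto
  finally show ?case by simp
qed auto

lemma iter_tendsto: "x \<in> {0..1} \<Longrightarrow> (\<lambda>n. (g ^^ n) x) \<longlonglongrightarrow> 0"
  by (rule tendsto_sandwich[of "\<lambda>_. 0" _ _ "\<lambda>n. c ^ n"])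
     (use iter_maps iter_le LIMSEQ_realpow_zero[OF c_nonneg c_less] in auto)

lemma cont_comp:
  assumes "continuous_on {0..1} v"
  shows "continuous_on {0..1} (\<lambda>x. v (g x))"
  by (rule continuous_on_compose2[OF assms cont]) (use maps in auto)

lemma cont_iter_tendsto:
  assumes "continuous_on {0..1} v" "x \<in> {0..1}"
  shows "(\<lambda>n. v ((g ^^ n) x)) \<longlonglongrightarrow> v 0"
  by (rule continuous_on_tendsto_compose[OF assms(1) iter_tendsto[OF assms(2)]])
     (use iter_maps[OF assms(2)] in auto)

text \<open>
  One step of the equation costs \<open>K \<bar>x - y\<bar>\<^sup>\<alpha>\<close> and replaces the pair by one that is closer by
  the factor \<open>c\<close>; the geometric series of these costs bounds the Hoelder constant. Because of
  \<open>\<alpha> > 0\<close>, the bound \<open>\<bar>a\<bar> \<le> 1\<close> is enough.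
\<close>

lemma holder_solution:
  assumes \<alpha>: "0 < \<alpha>" "\<alpha> \<le> 1" and cv: "continuous_on {0..1} v"
    and eq: "\<And>x. x \<in> {0..1} \<Longrightarrow> v x = \<psi> x + a x * v (g x)"
    and a1: "\<And>x. x \<in> {0..1} \<Longrightarrow> \<bar>a x\<bar> \<le> 1"
    and h\<psi>: "holder01 \<alpha> \<psi>" and ha: "holder01 \<alpha> a"
  shows "holder01 \<alpha> v"
proof -
  obtain P where P: "\<And>x y. x \<in> {0..1} \<Longrightarrow> y \<in> {0..1} \<Longrightarrow> \<bar>\<psi> x - \<psi> y\<bar> \<le> P * \<bar>x - y\<bar> powr \<alpha>"
    using holder01_bound[OF h\<psi>] by metis
  obtain A where A0: "A \<ge> 0"
    and A: "\<And>x y. x \<in> {0..1} \<Longrightarrow> y \<in> {0..1} \<Longrightarrow> \<bar>a x - a y\<bar> \<le> A * \<bar>x - y\<bar> powr \<alpha>"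
    using holder01_bound[OF ha] by metis
  obtain S where S: "\<And>x. x \<in> {0..1} \<Longrightarrow> \<bar>v x\<bar> \<le> S" using bounded_on01[OF cv] by metis
  define K where "K = P + A * S"
  have K0: "0 \<le> K"
  proof -
    have "0 \<le> P" using P[of 0 1] by simp
    moreover have "0 \<le> S" using S[of 0] by simp
    ultimately show ?thesis using A0 by (simp add: K_def)
  qed
  have step: "\<bar>v x - v y\<bar> \<le> K * \<bar>x - y\<bar> powr \<alpha> + \<bar>v (g x) - v (g y)\<bar>"
    if xy: "x \<in> {0..1}" "y \<in> {0..1}" for x y
  proof -
    have "v x - v y = (\<psi> x - \<psi> y) + ((a x - a y) * v (g x) + a y * (v (g x) - v (g y)))"
      using eq[OF xy(1)] eq[OF xy(2)] by (simp add: algebra_simps)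
    then have "\<bar>v x - v y\<bar> \<le> \<bar>\<psi> x - \<psi> y\<bar> + (\<bar>a x - a y\<bar> * \<bar>v (g x)\<bar> + \<bar>a y\<bar> * \<bar>v (g x) - v (g y)\<bar>)"
      using abs_triangle_ineq[of "\<psi> x - \<psi> y" "(a x - a y) * v (g x) + a y * (v (g x) - v (g y))"]
        abs_triangle_ineq[of "(a x - a y) * v (g x)" "a y * (v (g x) - v (g y))"]
      unfolding abs_mult by linarith
    also have "\<dots> \<le> P * \<bar>x - y\<bar> powr \<alpha> + (A * \<bar>x - y\<bar> powr \<alpha> * S + 1 * \<bar>v (g x) - v (g y)\<bar>)"
      using P[OF xy] A[OF xy] S[OF maps[OF xy(1)]] a1[OF xy(2)] A0
      by (intro add_mono mult_mono) auto
    finally show ?thesis by (simp add: K_def algebra_simps)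
  qed
  define q where "q = c powr \<alpha>"
  have q: "q < 1" "0 \<le> q"
    using powr_less_mono2[of \<alpha> c 1] c_less c_nonneg \<alpha> by (auto simp: q_def)
  define D where "D = K / (1 - q)"
  have D: "K + D * q = D" and D0: "0 \<le> D" using q K0 by (auto simp: D_def field_simps)
  have iter: "\<bar>v x - v y\<bar> \<le> D * \<bar>x - y\<bar> powr \<alpha> + \<bar>v ((g ^^ n) x) - v ((g ^^ n) y)\<bar>"
    if "x \<in> {0..1}" "y \<in> {0..1}" for x y n
    using that
  proof (induction n arbitrary: x y)
    case 0
    then show ?case using D0 by simp
  next
    case (Suc n)
    have "\<bar>g x - g y\<bar> powr \<alpha> \<le> (c * \<bar>x - y\<bar>) powr \<alpha>"
      using lip[OF Suc.prems] \<alpha> by (intro powr_mono2) auto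
    also have "\<dots> = q * \<bar>x - y\<bar> powr \<alpha>" using c_nonneg by (simp add: powr_mult q_def)
    finally have "D * \<bar>g x - g y\<bar> powr \<alpha> \<le> D * (q * \<bar>x - y\<bar> powr \<alpha>)"
      using D0 by (rule mult_left_mono)
    then have *: "\<bar>v (g x) - v (g y)\<bar>
        \<le> D * (q * \<bar>x - y\<bar> powr \<alpha>) + \<bar>v ((g ^^ n) (g x)) - v ((g ^^ n) (g y))\<bar>"
      using Suc.IH[OF maps[OF Suc.prems(1)] maps[OF Suc.prems(2)]] by linarith
    have "K * \<bar>x - y\<bar> powr \<alpha> + D * (q * \<bar>x - y\<bar> powr \<alpha>) = D * \<bar>x - y\<bar> powr \<alpha>"
      by (subst (2) D[symmetric]) (simp add: algebra_simps)
    then show ?case using step[OF Suc.prems] * by (simp add: funpow_Suc_right del: funpow.simps)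
  qed
  have "\<bar>v x - v y\<bar> \<le> D * \<bar>x - y\<bar> powr \<alpha>" if xy: "x \<in> {0..1}" "y \<in> {0..1}" for x y
  proof (rule LIMSEQ_le_const)
    show "(\<lambda>n. D * \<bar>x - y\<bar> powr \<alpha> + \<bar>v ((g ^^ n) x) - v ((g ^^ n) y)\<bar>) \<longlonglongrightarrow> D * \<bar>x - y\<bar> powr \<alpha>"
      by (rule tendsto_eq_intros cont_iter_tendsto[OF cv] xy | simp)+
  qed (use iter[OF xy] in blast)
  then show ?thesis unfolding holder01_def by blast
qed

text \<open>
  Differentiating the equation formally shows what the derivative has to be; it is obtained as the
  uniform limit of the derivatives of the iterates that start at the constant \<open>v 0\<close>.
\<close>

lemma C1_solution:
  assumes cv: "continuous_on {0..1} v"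
    and eq: "\<And>x. x \<in> {0..1} \<Longrightarrow> v x = \<psi> x + a x * v (g x)"
    and a1: "\<And>x. x \<in> {0..1} \<Longrightarrow> \<bar>a x\<bar> \<le> 1"
    and d\<psi>: "deriv_on01 \<psi> \<psi>'" "continuous_on {0..1} \<psi>'"
    and da: "deriv_on01 a a'" "continuous_on {0..1} a'"
    and cg': "continuous_on {0..1} g'"
  obtains w where "deriv_on01 v w" "continuous_on {0..1} w"
proof -
  have "holder01 1 v"
    using holder01_of_deriv[OF _ _ d\<psi>] holder01_of_deriv[OF _ _ da]
    by (intro holder_solution[OF _ _ cv eq a1]) auto
  then obtain L where "L \<ge> 0" and
    L: "\<And>x y. x \<in> {0..1} \<Longrightarrow> y \<in> {0..1} \<Longrightarrow> \<bar>v x - v y\<bar> \<le> L * \<bar>x - y\<bar> powr 1"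
    by (metis holder01_bound)
  define vn where "vn = rec_nat (\<lambda>x. v 0) (\<lambda>n f x. \<psi> x + a x * f (g x))"
  have vn0: "vn 0 x = v 0" and vnS: "vn (Suc n) x = \<psi> x + a x * vn n (g x)" for n x
    by (simp_all add: vn_def)
  define wn where "wn = rec_nat (\<lambda>x. 0) (\<lambda>n f x. \<psi>' x + a' x * vn n (g x) + a x * g' x * f (g x))"
  have wn0: "wn 0 x = 0"
    and wnS: "wn (Suc n) x = \<psi>' x + a' x * vn n (g x) + a x * g' x * wn n (g x)" for n x
    by (simp_all add: wn_def)
  have ca: "continuous_on {0..1} a" and c\<psi>: "continuous_on {0..1} \<psi>"
    using da d\<psi> deriv_on01_cont by blast+
  have cvn: "continuous_on {0..1} (vn n)" for n
    by (induction n) (auto simp: vn0 vnS[abs_def] intro!: continuous_intros ca c\<psi> cont_comp)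
  have cwn: "continuous_on {0..1} (wn n)" for n
    by (induction n)
      (auto simp: wn0 wnS[abs_def] intro!: continuous_intros ca da(2) d\<psi>(2) cg' cont_comp[OF cvn] cont_comp)
  have near: "\<bar>vn n x - v x\<bar> \<le> L * c ^ n * x" if "x \<in> {0..1}" for n x
    using that
  proof (induction n arbitrary: x)
    case 0
    then show ?case using L[of 0 x] by (simp add: vn0)
  next
    case (Suc n)
    have "\<bar>vn (Suc n) x - v x\<bar> = \<bar>a x\<bar> * \<bar>vn n (g x) - v (g x)\<bar>"
      unfolding abs_mult[symmetric] vnS eq[OF Suc.prems] by (simp add: algebra_simps)
    also have "\<dots> \<le> 1 * (L * c ^ n * g x)"
      using a1[OF Suc.prems] Suc.IH[OF maps[OF Suc.prems]] by (intro mult_mono) auto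
    also have "\<dots> \<le> 1 * (L * c ^ n * (c * x))"
      using g_le[OF Suc.prems] \<open>L \<ge> 0\<close> c_nonneg by (intro mult_left_mono) auto
    finally show ?case by (simp add: algebra_simps)
  qed
  have near1: "\<bar>vn n x - v x\<bar> \<le> L * c ^ n" if "x \<in> {0..1}" for n x
    using near[OF that, of n] that \<open>L \<ge> 0\<close> c_nonneg mult_left_mono[of x 1 "L * c ^ n"] by auto
  have dvn: "deriv_on01 (vn n) (wn n)" for n
  proof (induction n)
    case 0
    then show ?case by (auto simp: vn0[abs_def] wn0)
  next
    case (Suc n)
    show ?case
    proof
      fix x :: real assume x: "x \<in> {0..1}"
      have "((\<lambda>x. vn n (g x)) has_real_derivative wn n (g x) * g' x) (at x within {0..1})"
        using deriv_on01_comp[OF Suc deriv maps] x by blast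
      from DERIV_add[OF bspec[OF d\<psi>(1) x] DERIV_mult'[OF bspec[OF da(1) x] this]]
      show "(vn (Suc n) has_real_derivative wn (Suc n) x) (at x within {0..1})"
        by (simp add: vnS[abs_def] wnS algebra_simps)
    qed
  qed
  obtain A where A: "A > 0" "\<And>x. x \<in> {0..1} \<Longrightarrow> \<bar>a' x\<bar> \<le> A" using bounded_on01[OF da(2)] by metis
  obtain P where P: "P > 0" "\<And>x. x \<in> {0..1} \<Longrightarrow> \<bar>wn (Suc 0) x\<bar> \<le> P"
    using bounded_on01[OF cwn[of "Suc 0"]] by metis
  define \<kappa> where "\<kappa> = (1 + c) / 2"
  have \<kappa>: "c < \<kappa>" "\<kappa> < 1" "0 \<le> \<kappa>" using c_nonneg c_less by (auto simp: \<kappa>_def)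
  \<comment> \<open>The constant is chosen such that the recursion for the differences reproduces the bound.\<close>
  define K where "K = P + 2 * A * L / (\<kappa> - c)"
  have K: "P \<le> K" "2 * A * L + c * K \<le> K * \<kappa>"
  proof -
    show "P \<le> K" using A \<open>L \<ge> 0\<close> \<kappa> by (auto simp: K_def intro!: divide_nonneg_nonneg)
    have "2 * A * L = (2 * A * L / (\<kappa> - c)) * (\<kappa> - c)" using \<kappa> by simp
    also have "\<dots> \<le> K * (\<kappa> - c)" using P \<kappa> by (intro mult_right_mono) (auto simp: K_def)
    finally show "2 * A * L + c * K \<le> K * \<kappa>" by (simp add: algebra_simps)
  qed
  have K0: "0 \<le> K" using K P by linarith
  have cauchy: "\<bar>wn (Suc n) x - wn n x\<bar> \<le> K * \<kappa> ^ n" if "x \<in> {0..1}" for n x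
    using that
  proof (induction n arbitrary: x)
    case 0
    then show ?case using P K by (auto simp: wn0 intro: order_trans)
  next
    case (Suc n)
    have gx: "g x \<in> {0..1}" using maps Suc.prems by blast
    have "\<bar>vn (Suc n) (g x) - vn n (g x)\<bar> \<le> L * c ^ Suc n + L * c ^ n"
      using near1[OF gx, of n] near1[OF gx, of "Suc n"] by linarith
    also have "\<dots> \<le> L * c ^ n + L * c ^ n"
      using \<open>L \<ge> 0\<close> c_nonneg c_less by (intro add_mono mult_left_mono power_decreasing) auto
    also have "\<dots> \<le> 2 * L * \<kappa> ^ n"
      using \<open>L \<ge> 0\<close> c_nonneg \<kappa> by (simp add: mult_left_mono power_mono)
    finally have v: "\<bar>vn (Suc n) (g x) - vn n (g x)\<bar> \<le> 2 * L * \<kappa> ^ n" .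
    have "wn (Suc (Suc n)) x - wn (Suc n) x =
        a' x * (vn (Suc n) (g x) - vn n (g x)) + a x * g' x * (wn (Suc n) (g x) - wn n (g x))"
      by (subst (1 2) wnS) (simp add: algebra_simps)
    then have "\<bar>wn (Suc (Suc n)) x - wn (Suc n) x\<bar> \<le>
        \<bar>a' x\<bar> * \<bar>vn (Suc n) (g x) - vn n (g x)\<bar> + \<bar>a x\<bar> * \<bar>g' x\<bar> * \<bar>wn (Suc n) (g x) - wn n (g x)\<bar>"
      by (metis abs_mult abs_triangle_ineq)
    also have "\<dots> \<le> A * (2 * L * \<kappa> ^ n) + 1 * c * (K * \<kappa> ^ n)"
      using A Suc.prems v a1 bound Suc.IH[OF gx] c_nonneg by (intro add_mono mult_mono) auto
    also have "\<dots> = (2 * A * L + c * K) * \<kappa> ^ n" by (simp add: algebra_simps)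
    also have "\<dots> \<le> K * \<kappa> * \<kappa> ^ n" using K \<kappa> by (intro mult_right_mono) auto
    finally show ?case by simp
  qed
  obtain w where w: "uniform_limit {0..1} wn w sequentially"
    using uniform_limit_geometric[of "{0..1}" wn K \<kappa>] cauchy \<kappa> by blast
  have cw: "continuous_on {0..1} w"
    by (rule uniform_limit_theorem[OF _ w]) (auto simp: cwn)
  have lim: "(\<lambda>n. vn n x) \<longlonglongrightarrow> v x" if "x \<in> {0..1}" for x
  proof (rule LIM_zero_cancel, rule Lim_null_comparison)
    show "\<forall>\<^sub>F n in sequentially. norm (vn n x - v x) \<le> L * c ^ n"
      using near1[OF that] by (auto simp: norm_real)
    show "(\<lambda>n. L * c ^ n) \<longlonglongrightarrow> 0"
      using tendsto_mult_left[OF LIMSEQ_realpow_zero[OF c_nonneg c_less], of L] by simp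
  qed
  have "\<exists>G. \<forall>x\<in>{0..1}. (\<lambda>n. vn n x) \<longlonglongrightarrow> G x \<and>
      (G has_derivative (\<lambda>h. w x * h)) (at x within {0..1})"
  proof (rule has_derivative_sequence[where f' = "\<lambda>n x h. wn n x * h"])
    show "(vn n has_derivative (\<lambda>h. wn n x * h)) (at x within {0..1})" if "x \<in> {0..1}" for n x
      using dvn that unfolding has_field_derivative_def by blast
    show "\<forall>\<^sub>F n in sequentially. \<forall>x\<in>{0..1}. \<forall>h. norm (wn n x * h - w x * h) \<le> e * norm h"
      if "e > 0" for e
      using uniform_limitD[OF w that]
      by eventually_elim
        (auto simp: dist_real_def norm_real abs_mult left_diff_distrib[symmetric] intro!: mult_right_mono[OF less_imp_le])
    show "(0 :: real) \<in> {0..1}" by simp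
    show "(\<lambda>n. vn n 0) \<longlonglongrightarrow> v 0" by (rule lim) simp
  qed auto
  then obtain G where G: "\<And>x. x \<in> {0..1} \<Longrightarrow> (\<lambda>n. vn n x) \<longlonglongrightarrow> G x"
    and dG: "deriv_on01 G w"
    unfolding has_field_derivative_def by blast
  have "G x = v x" if "x \<in> {0..1}" for x using LIMSEQ_unique[OF G lim] that by blast
  then have "deriv_on01 v w" by (intro deriv_on01_cong[OF dG]) auto
  then show ?thesis using that cw by blast
qed

text \<open>
  A continuous solution of \<open>v = \<psi> + a \<cdot> (v \<circ> g)\<close> is as regular as the data: the derivative
  solves an equation of the same kind, with \<open>a \<cdot> g'\<close> in place of \<open>a\<close>.
\<close>

lemma CH_solution:
  assumes \<alpha>: "0 < \<alpha>" "\<alpha> \<le> 1" and cv: "continuous_on {0..1} v"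
    and eq: "\<And>x. x \<in> {0..1} \<Longrightarrow> v x = \<psi> x + a x * v (g x)"
    and a1: "\<And>x. x \<in> {0..1} \<Longrightarrow> \<bar>a x\<bar> \<le> 1"
    and "CH \<alpha> m \<psi>" "CH \<alpha> m a" "CH \<alpha> m g"
  shows "CH \<alpha> m v"
  using cv eq a1 assms(6-8)
proof (induction m arbitrary: v \<psi> a)
  case 0
  then show ?case using holder_solution[OF \<alpha>] by simp
next
  case (Suc m)
  obtain \<psi>' where \<psi>': "deriv_on01 \<psi> \<psi>'" "CH \<alpha> m \<psi>'" using Suc.prems by auto
  obtain a' where a': "deriv_on01 a a'" "CH \<alpha> m a'" using Suc.prems by auto
  have g': "CH \<alpha> m g'" using Suc.prems(6) CH_Suc_iff[OF deriv] by blast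
  have lower: "CH \<alpha> m \<psi>" "CH \<alpha> m a" "CH \<alpha> m g"
    using CH_SucD[OF \<alpha>] Suc.prems by blast+
  obtain w where w: "deriv_on01 v w" "continuous_on {0..1} w"
    using C1_solution[OF Suc.prems(1-3) \<psi>'(1) CH_cont[OF \<alpha>(1) \<psi>'(2)] a'(1) CH_cont[OF \<alpha>(1) a'(2)]
        CH_cont[OF \<alpha>(1) g']] by blast
  have "CH \<alpha> m v" by (rule Suc.IH[OF Suc.prems(1-3) lower])
  from CH_comp[OF \<alpha> this lower(3) maps lip] have vg: "CH \<alpha> m (\<lambda>x. v (g x))" .
  have "deriv_on01 (\<lambda>x. \<psi> x + a x * v (g x)) (\<lambda>x. (\<psi>' x + a' x * v (g x)) + a x * g' x * w (g x))"
  proof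
    fix x :: real assume x: "x \<in> {0..1}"
    have "((\<lambda>x. v (g x)) has_real_derivative w (g x) * g' x) (at x within {0..1})"
      using deriv_on01_comp[OF w(1) deriv maps] x by blast
    from DERIV_add[OF bspec[OF \<psi>'(1) x] DERIV_mult'[OF bspec[OF a'(1) x] this]]
    show "((\<lambda>x. \<psi> x + a x * v (g x)) has_real_derivative
        (\<psi>' x + a' x * v (g x)) + a x * g' x * w (g x)) (at x within {0..1})"
      by (simp add: algebra_simps)
  qed
  then have "deriv_on01 v (\<lambda>x. (\<psi>' x + a' x * v (g x)) + a x * g' x * w (g x))"
    by (rule deriv_on01_cong) (erule Suc.prems(2)[symmetric], rule refl)
  from deriv_on01_unique[OF w(1) this]
  have weq: "w x = (\<psi>' x + a' x * v (g x)) + a x * g' x * w (g x)" if "x \<in> {0..1}" for x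
    using that by blast
  have le1: "\<bar>a x * g' x\<bar> \<le> 1" if "x \<in> {0..1}" for x
  proof -
    have "\<bar>a x\<bar> * \<bar>g' x\<bar> \<le> 1 * 1"
      using Suc.prems(3)[OF that] bound[OF that] c_less by (intro mult_mono) auto
    then show ?thesis by (simp add: abs_mult)
  qed
  have "CH \<alpha> m w"
    by (rule Suc.IH[OF w(2) weq le1 CH_add[OF \<psi>'(2) CH_mult[OF \<alpha> a'(2) vg]]
          CH_mult[OF \<alpha> lower(2) g'] lower(3)])
  then show ?case using w(1) by auto
qed

text \<open>
  The density of the linearising coordinate of \<open>g\<close> at its fixed point \<open>0\<close>, as in Koenigs' and
  Sternberg's theorem; its logarithm is the sum of \<open>ln (g' / l)\<close> along the forward orbit.
\<close>

lemma koenigs_density: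
  assumes pos: "\<And>x. x \<in> {0..1} \<Longrightarrow> 0 < g' x" and l: "g' 0 = l"
    and \<alpha>0: "0 < \<alpha>0" "\<alpha>0 \<le> 1" and reg: "CH \<alpha>0 (Suc 0) g"
  obtains \<rho> where "continuous_on {0..1} \<rho>" "\<And>x. x \<in> {0..1} \<Longrightarrow> 0 < \<rho> x"
    "\<And>x. x \<in> {0..1} \<Longrightarrow> \<rho> (g x) * g' x = l * \<rho> x"
    "\<And>\<alpha> m. 0 < \<alpha> \<Longrightarrow> \<alpha> \<le> 1 \<Longrightarrow> CH \<alpha> (Suc m) g \<Longrightarrow> CH \<alpha> m \<rho>"
proof -
  have l0: "0 < l" using pos[of 0] l by simp
  define \<phi> where "\<phi> x = ln (g' x * (1 / l))" for x
  have CH\<phi>: "CH \<alpha> m \<phi>" if "0 < \<alpha>" "\<alpha> \<le> 1" "CH \<alpha> (Suc m) g" for \<alpha> m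
  proof -
    have "CH \<alpha> m g'" using that CH_Suc_iff[OF deriv] by blast
    from CH_ln[OF that(1,2) CH_mult[OF that(1,2) this CH_const[of \<alpha> m "1 / l"]]] show ?thesis
      using pos l0 unfolding \<phi>_def by simp
  qed
  have \<phi>0: "\<phi> 0 = 0" using l l0 by (simp add: \<phi>_def)
  obtain C where C: "C \<ge> 0"
    "\<And>x y. x \<in> {0..1} \<Longrightarrow> y \<in> {0..1} \<Longrightarrow> \<bar>\<phi> x - \<phi> y\<bar> \<le> C * \<bar>x - y\<bar> powr \<alpha>0"
    using holder01_bound CH\<phi>[OF \<alpha>0 reg] by (metis CH.simps(1))
  have c\<phi>: "continuous_on {0..1} \<phi>" by (rule CH_cont[OF \<alpha>0(1) CH\<phi>[OF \<alpha>0 reg]])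
  define un where "un n x = (\<Sum>k<n. \<phi> ((g ^^ k) x))" for n x
  define q where "q = c powr \<alpha>0"
  have q: "q < 1" "0 \<le> q"
    using powr_less_mono2[of \<alpha>0 c 1] c_less c_nonneg \<alpha>0 by (auto simp: q_def)
  have cpos: "0 < c" using pos[of 0] bound[of 0] by simp
  have "\<bar>un (Suc n) x - un n x\<bar> \<le> C * q ^ n" if x: "x \<in> {0..1}" for n x
  proof -
    have "\<bar>un (Suc n) x - un n x\<bar> = \<bar>\<phi> ((g ^^ n) x) - \<phi> 0\<bar>" by (simp add: un_def \<phi>0)
    also have "\<dots> \<le> C * \<bar>(g ^^ n) x - 0\<bar> powr \<alpha>0"
      using C(2)[OF iter_maps[OF x, of n], of 0] by simp
    also have "\<dots> \<le> C * (c ^ n) powr \<alpha>0"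
      using iter_maps[OF x, of n] iter_le[OF x, of n] \<alpha>0 C(1) by (intro mult_left_mono powr_mono2) auto
    also have "(c ^ n) powr \<alpha>0 = q ^ n" using cpos by (simp add: q_def powr_power powr_realpow[symmetric] powr_powr mult.commute)
    finally show ?thesis .
  qed
  then obtain u where u: "uniform_limit {0..1} un u sequentially"
    using uniform_limit_geometric[of "{0..1}" un C q] q by blast
  have lim: "(\<lambda>n. un n x) \<longlonglongrightarrow> u x" if "x \<in> {0..1}" for x
    by (rule tendsto_uniform_limitI[OF u that])
  have itc: "continuous_on {0..1} (\<lambda>x. (g ^^ k) x)" for k
  proof (induction k)
    case (Suc k)
    show ?case unfolding funpow_Suc_right o_apply by (rule cont_comp[OF Suc])
  qed auto
  have "continuous_on {0..1} (un n)" for n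
    unfolding un_def by (intro continuous_on_sum continuous_on_compose2[OF c\<phi> itc]) (use iter_maps in auto)
  then have cu: "continuous_on {0..1} u"
    by (intro uniform_limit_theorem[OF _ u]) auto
  have ueq: "u x = \<phi> x + 1 * u (g x)" if x: "x \<in> {0..1}" for x
  proof (rule LIMSEQ_unique)
    show "(\<lambda>n. un (Suc n) x) \<longlonglongrightarrow> u x" by (rule LIMSEQ_Suc[OF lim[OF x]])
    have "un (Suc n) x = \<phi> x + un n (g x)" for n
      by (simp add: un_def sum.lessThan_Suc_shift funpow_Suc_right del: funpow.simps sum.lessThan_Suc)
    then show "(\<lambda>n. un (Suc n) x) \<longlonglongrightarrow> \<phi> x + 1 * u (g x)"
      using tendsto_add[OF tendsto_const lim[OF maps[OF x]]] by simp
  qed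
  show ?thesis
  proof (rule that[of "\<lambda>x. exp (u x)"])
    fix x :: real assume x: "x \<in> {0..1}"
    have "exp (\<phi> x) = g' x / l" using pos[OF x] l0 by (simp add: \<phi>_def)
    then show "exp (u (g x)) * g' x = l * exp (u x)"
      using ueq[OF x] l0 by (simp add: exp_add)
  next
    fix \<alpha> :: real and m assume \<alpha>: "0 < \<alpha>" "\<alpha> \<le> 1" and r: "CH \<alpha> (Suc m) g"
    have "CH \<alpha> m u"
      by (rule CH_solution[OF \<alpha> cu ueq _ CH\<phi>[OF \<alpha> r] CH_const CH_SucD[OF \<alpha> r]]) auto
    then show "CH \<alpha> m (\<lambda>x. exp (u x))" by (rule CH_exp[OF \<alpha>])
  qed (auto intro!: continuous_intros cu)
qed

end

section \<open>Words, fixed points and attractors\<close>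

lemma word_map_Nil [simp]: "word_map g [] x = x"
  and word_map_Cons [simp]: "word_map g (i # w) x = g i (word_map g w x)"
  by (simp_all add: word_map_def)

lemma word_map_append: "word_map g (v @ w) x = word_map g v (word_map g w x)"
  by (induction v) auto

text \<open>A pair of contractions of \<open>[0,1]\<close> with a common Lipschitz constant \<open>c < 1\<close>.\<close>

locale lipschitz_ifs =
  fixes g :: ifs and c :: real
  assumes maps: "x \<in> {0..1} \<Longrightarrow> g i x \<in> {0..1}"
    and lip: "x \<in> {0..1} \<Longrightarrow> y \<in> {0..1} \<Longrightarrow> \<bar>g i x - g i y\<bar> \<le> c * \<bar>x - y\<bar>"
    and c_nonneg: "0 \<le> c" and c_less: "c < 1"
begin

lemma word_maps: "x \<in> {0..1} \<Longrightarrow> word_map g w x \<in> {0..1}"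
  by (induction w) (simp_all add: maps del: atLeastAtMost_iff)

lemma word_lip:
  assumes "x \<in> {0..1}" "y \<in> {0..1}"
  shows "\<bar>word_map g w x - word_map g w y\<bar> \<le> c ^ length w * \<bar>x - y\<bar>"
proof (induction w)
  case (Cons i w)
  have "\<bar>word_map g (i # w) x - word_map g (i # w) y\<bar> \<le> c * \<bar>word_map g w x - word_map g w y\<bar>"
    unfolding word_map_Cons by (intro lip word_maps assms)
  also have "\<dots> \<le> c * (c ^ length w * \<bar>x - y\<bar>)" using Cons c_nonneg by (intro mult_left_mono)
  finally show ?case by simp
qed simp

lemma word_close:
  assumes "x \<in> {0..1}" "y \<in> {0..1}"
  shows "\<bar>word_map g w x - word_map g w y\<bar> \<le> c ^ length w"
proof -
  have "c ^ length w * \<bar>x - y\<bar> \<le> c ^ length w * 1"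
    using assms c_nonneg by (intro mult_left_mono) auto
  then show ?thesis using word_lip[OF assms, of w] by simp
qed

lemma ex1_fix:
  assumes "w \<noteq> []"
  shows "\<exists>!y. y \<in> {0..1} \<and> word_map g w y = y"
proof -
  have "c ^ length w < 1" using assms c_nonneg c_less by (simp add: power_less_one_iff)
  moreover have "complete {0..1::real}" by (simp add: compact_imp_complete)
  ultimately have "\<exists>!y\<in>{0..1}. word_map g w y = y"
    using word_lip word_maps c_nonneg
    by (intro Banach_fix[of "{0..1}" "c ^ length w" "word_map g w"])
      (auto simp: dist_real_def simp del: atLeastAtMost_iff)
  then show ?thesis by simp
qed

lemma word_fix:
  assumes "w \<noteq> []"
  shows "word_fix g w \<in> {0..1}" "word_map g w (word_fix g w) = word_fix g w"
  using theI'[OF ex1_fix[OF assms]] unfolding word_fix_def by auto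

lemma word_fix_eqI:
  assumes "w \<noteq> []" "y \<in> {0..1}" "word_map g w y = y"
  shows "word_fix g w = y"
  using ex1_fix[OF assms(1)] word_fix[OF assms(1)] assms by blast

lemma cont: "continuous_on {0..1} (g i)"
proof -
  have "c-lipschitz_on {0..1} (g i)"
    using lip c_nonneg by (intro lipschitz_onI) (auto simp: dist_real_def)
  then show ?thesis by (rule lipschitz_on_continuous_on)
qed

text \<open>The property that characterises the attractor.\<close>

definition invariant_compact :: "real set \<Rightarrow> bool" where
  "invariant_compact X \<longleftrightarrow> X \<noteq> {} \<and> compact X \<and> X \<subseteq> {0..1} \<and> X = g False ` X \<union> g True ` X"

lemma invariant_factor:
  assumes "invariant_compact X" "x \<in> X"
  shows "\<exists>w y. length w = n \<and> y \<in> X \<and> x = word_map g w y"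
  using assms(2)
proof (induction n arbitrary: x)
  case 0
  then show ?case by (auto intro: exI[of _ "[]"])
next
  case (Suc n)
  then obtain i x' where x': "x' \<in> X" "x = g i x'"
    using assms(1) unfolding invariant_compact_def by blast
  with Suc obtain w y where "length w = n" "y \<in> X" "x' = word_map g w y" by blast
  then show ?case using x' by (intro exI[of _ "i # w"] exI[of _ y]) auto
qed

lemma invariant_word:
  assumes "invariant_compact X" "y \<in> X"
  shows "word_map g w y \<in> X"
proof (induction w)
  case (Cons i w)
  then show ?case using assms(1) unfolding invariant_compact_def by (cases i) auto
qed (use assms in simp)

lemma invariant_subset:
  assumes X: "invariant_compact X" and Y: "invariant_compact Y"
  shows "X \<subseteq> Y"
proof
  fix x assume x: "x \<in> X"
  obtain y where y: "y \<in> Y" using Y unfolding invariant_compact_def by blast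
  have "\<exists>z\<in>Y. dist z x < e" if e: "e > 0" for e
  proof -
    obtain n where n: "c ^ n < e" using real_arch_pow_inv[OF e c_less] by blast
    obtain w x' where w: "length w = n" "x' \<in> X" "x = word_map g w x'"
      using invariant_factor[OF X x] by metis
    have "\<bar>word_map g w y - word_map g w x'\<bar> \<le> c ^ n"
      using word_close[of y x' w] X Y y w unfolding invariant_compact_def by blast
    then have "dist (word_map g w y) x < e" using w n by (simp add: dist_real_def)
    then show ?thesis using invariant_word[OF Y y, of w] by blast
  qed
  then have "x \<in> closure Y" by (simp add: closure_approachable)
  moreover have "closed Y" using Y compact_imp_closed unfolding invariant_compact_def by blast
  ultimately show "x \<in> Y" by (simp add: closure_closed)
qed

text \<open>The closure of the orbit of a fixed point under all words is invariant.\<close>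

lemma ex_invariant: "\<exists>X. invariant_compact X"
proof -
  define p where "p = word_fix g [False]"
  have p: "p \<in> {0..1}" "g False p = p" using word_fix[of "[False]"] by (auto simp: p_def)
  define S where "S = range (\<lambda>w. word_map g w p)"
  have SI: "S \<subseteq> {0..1}" using word_maps p by (auto simp: S_def)
  have img: "g False ` S \<union> g True ` S = S"
  proof
    show "g False ` S \<union> g True ` S \<subseteq> S"
      by (auto simp: S_def simp flip: word_map_Cons)
    show "S \<subseteq> g False ` S \<union> g True ` S"
    proof
      fix x assume "x \<in> S"
      then obtain w where w: "x = word_map g w p" by (auto simp: S_def)
      show "x \<in> g False ` S \<union> g True ` S"
      proof (cases w)
        case Nil
        then have "x = g False (word_map g [] p)" using w p by simp
        then show ?thesis unfolding S_def by blast
      next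
        case (Cons i v)
        then have "x = g i (word_map g v p)" using w by simp
        then have "x \<in> g i ` S" unfolding S_def by blast
        then show ?thesis by (cases i) auto
      qed
    qed
  qed
  have clI: "closure S \<subseteq> {0..1}" by (rule closure_minimal[OF SI]) simp
  have cmp: "compact (closure S)"
    by (rule compact_Int_closed[of "{0..1}" "closure S", unfolded Int_absorb1[OF clI]]) auto
  have c: "continuous_on (closure S) (g i)" for i using cont clI by (rule continuous_on_subset)
  have "g i ` closure S \<subseteq> closure (g i ` S)" for i
    by (rule image_closure_subset[OF c closed_closure closure_subset])
  moreover have "closure (g i ` S) \<subseteq> g i ` closure S" for i
    by (intro closure_minimal image_mono closure_subset compact_imp_closed compact_continuous_image c cmp)
  ultimately have "closure (g i ` S) = g i ` closure S" for i by blast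
  then have "closure S = g False ` closure S \<union> g True ` closure S"
    using arg_cong[OF img, of closure] by simp
  moreover have "S \<noteq> {}" by (auto simp: S_def)
  ultimately have "invariant_compact (closure S)"
    using clI cmp unfolding invariant_compact_def by simp
  then show ?thesis by blast
qed

lemma invariant_attractor: "invariant_compact (attractor g)"
proof -
  have "\<exists>!X. invariant_compact X" using ex_invariant invariant_subset by blast
  from theI'[OF this] show ?thesis unfolding attractor_def invariant_compact_def .
qed

lemma attractor_approx:
  assumes "x \<in> attractor g" "y \<in> {0..1}"
  shows "\<exists>w. length w = n \<and> \<bar>x - word_map g w y\<bar> \<le> c ^ n"
proof -
  obtain w x' where w: "length w = n" "x' \<in> attractor g" "x = word_map g w x'"
    using invariant_factor[OF invariant_attractor assms(1)] by blast
  then have "x' \<in> {0..1}" using invariant_attractor unfolding invariant_compact_def by blast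
  then show ?thesis using word_close[OF _ assms(2), of x' w] w by blast
qed

lemma fixed_in_attractor:
  assumes "x \<in> {0..1}" "g i x = x"
  shows "x \<in> attractor g"
proof -
  have inv: "invariant_compact (attractor g)" by (rule invariant_attractor)
  obtain y where y: "y \<in> attractor g" using inv unfolding invariant_compact_def by blast
  have yI: "y \<in> {0..1}" using y inv unfolding invariant_compact_def by blast
  have fixed: "word_map g (replicate n i) x = x" for n by (induction n) (auto simp: assms(2))
  have "norm (word_map g (replicate n i) y - x) \<le> c ^ n" for n
    using word_close[OF yI assms(1), of "replicate n i"] by (simp add: fixed)
  then have "(\<lambda>n. word_map g (replicate n i) y - x) \<longlonglongrightarrow> 0"
    by (intro Lim_null_comparison[OF _ LIMSEQ_realpow_zero[OF c_nonneg c_less]] always_eventually allI)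
  then have lim: "(\<lambda>n. word_map g (replicate n i) y) \<longlonglongrightarrow> x" by (rule LIM_zero_cancel)
  have "compact (attractor g)" using inv unfolding invariant_compact_def by simp
  then show ?thesis
    by (rule closed_sequentially[OF compact_imp_closed _ lim]) (rule invariant_word[OF inv y])
qed

end

lemma contractive_lipschitz_ifs:
  assumes "contractive_ifs f"
  obtains c where "lipschitz_ifs f c"
proof -
  have "\<forall>i. \<exists>c<1. c-lipschitz_on {0..1} (f i)" using assms unfolding contractive_ifs_def by blast
  then obtain c where c: "\<And>i. c i < 1" "\<And>i. (c i)-lipschitz_on {0..1} (f i)" by metis
  define C where "C = max (c False) (c True)"
  have le: "c i \<le> C" for i by (cases i) (auto simp: C_def)
  have L: "C-lipschitz_on {0..1} (f i)" for i
    by (rule lipschitz_on_le[OF c(2) le])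
  have "lipschitz_ifs f C"
  proof
    show "f i x \<in> {0..1}" if "x \<in> {0..1}" for i x
      using assms that unfolding contractive_ifs_def by blast
    show "\<bar>f i x - f i y\<bar> \<le> C * \<bar>x - y\<bar>" if "x \<in> {0..1}" "y \<in> {0..1}" for i x y
      using lipschitz_onD[OF L that] by (simp add: dist_real_def)
    show "0 \<le> C" using lipschitz_on_nonneg[OF L] .
    show "C < 1" using c(1) by (simp add: C_def)
  qed
  then show ?thesis by (rule that)
qed

text \<open>The derivative of \<open>G\<^sub>w\<close>, computed by the chain rule from derivatives \<open>D i\<close> of the maps.\<close>

primrec word_deriv :: "ifs \<Rightarrow> ifs \<Rightarrow> bool list \<Rightarrow> real \<Rightarrow> real" where
  "word_deriv g D [] x = 1"
| "word_deriv g D (i # w) x = D i (word_map g w x) * word_deriv g D w x"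

lemma word_deriv_append:
  "word_deriv g D (v @ w) x = word_deriv g D v (word_map g w x) * word_deriv g D w x"
  by (induction v) (auto simp: word_map_append)

text \<open>A pair of increasing \<open>C\<^sup>1\<close> contractions of \<open>[0,1]\<close> with derivatives \<open>D i\<close>.\<close>

locale diff_ifs =
  fixes g :: ifs and D :: ifs and c :: real
  assumes g_maps: "x \<in> {0..1} \<Longrightarrow> g i x \<in> {0..1}"
    and g_deriv: "deriv_on01 (g i) (D i)"
    and D_cont: "continuous_on {0..1} (D i)"
    and D_pos: "x \<in> {0..1} \<Longrightarrow> 0 < D i x"
    and D_le: "x \<in> {0..1} \<Longrightarrow> D i x \<le> c"
    and c_less_1: "c < 1"
begin

lemma D_abs: "x \<in> {0..1} \<Longrightarrow> \<bar>D i x\<bar> \<le> c"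
  using D_pos[of x i] D_le[of x i] by simp

sublocale lipschitz_ifs g c
proof
  show "\<bar>g i x - g i y\<bar> \<le> c * \<bar>x - y\<bar>" if "x \<in> {0..1}" "y \<in> {0..1}" for i x y
    by (rule deriv_on01_lipschitz[OF g_deriv D_abs that])
  show "0 \<le> c" using D_abs[of 0 False] by simp
qed (use g_maps c_less_1 in auto)

lemma word_deriv: "deriv_on01 (word_map g w) (word_deriv g D w)"
proof (induction w)
  case Nil
  have "word_map g [] = (\<lambda>x. x)" "word_deriv g D [] = (\<lambda>x. 1)" by (auto simp: fun_eq_iff)
  then show ?case by simp
next
  case (Cons i w)
  have "word_map g (i # w) = (\<lambda>x. g i (word_map g w x))"
    "word_deriv g D (i # w) = (\<lambda>x. D i (word_map g w x) * word_deriv g D w x)"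
    by (auto simp: fun_eq_iff)
  then show ?case using deriv_on01_comp[OF g_deriv Cons word_maps] by simp
qed

lemma word_deriv_pos: "x \<in> {0..1} \<Longrightarrow> 0 < word_deriv g D w x"
  by (induction w) (auto intro!: mult_pos_pos D_pos word_maps simp del: atLeastAtMost_iff)

lemma deriv01_word: "x \<in> {0..1} \<Longrightarrow> deriv01 (word_map g w) x = word_deriv g D w x"
  using word_deriv by (intro deriv01_eq) blast+

lemma word_deriv_cont: "continuous_on {0..1} (word_deriv g D w)"
proof (induction w)
  case Nil
  show ?case by (simp add: word_deriv.simps(1)[abs_def])
next
  case (Cons i w)
  have "continuous_on {0..1} (\<lambda>x. D i (word_map g w x))"
    by (rule continuous_on_compose2[OF D_cont deriv_on01_cont[OF word_deriv]]) (use word_maps in blast)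
  then show ?case unfolding word_deriv.simps(2)[abs_def] using Cons by (intro continuous_intros)
qed

lemma livsic_iff:
  "livsic l g \<longleftrightarrow> (\<forall>w. w \<noteq> [] \<longrightarrow> word_deriv g D w (word_fix g w) = l ^ length w)"
  unfolding livsic_def using deriv01_word word_fix(1) by metis

end

text \<open>
  Every class \<open>C\<^sup>s\<close> with \<open>s > 1\<close> is an intersection of Hoelder classes of order \<open>(m + 1, \<alpha>)\<close>: a
  single one for finite \<open>s\<close>, and those with \<open>\<alpha> = 1\<close> and arbitrary \<open>m\<close> for \<open>s = \<infinity>\<close>.
\<close>

lemma C_class_CH:
  assumes "1 < s"
  obtains J where "J \<noteq> {}" "\<And>\<alpha> m. (\<alpha>, m) \<in> J \<Longrightarrow> 0 < \<alpha> \<and> \<alpha> \<le> (1::real)"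
    "\<And>f. C_class s f \<longleftrightarrow> (\<forall>(\<alpha>, m)\<in>J. CH \<alpha> (Suc m) f)"
proof (cases "s = \<infinity>")
  case True
  have "(\<forall>r. C_int r f) \<longleftrightarrow> (\<forall>m. CH 1 (Suc m) f)" for f
  proof
    assume C: "\<forall>r. C_int r f"
    have "CH 1 m f" for m
    proof -
      have *: "C_int (Suc m) f \<Longrightarrow> CH 1 m f" for f
      proof (induction m arbitrary: f)
        case 0
        then have "deriv_on01 f (deriv01 f)" "continuous_on {0..1} (deriv01 f)"
          by (auto simp: C_int_Suc C_int_def[of 0])
        then show ?case using holder01_of_deriv[of 1] by simp
      next
        case (Suc m)
        then have "deriv_on01 f (deriv01 f)" "C_int (Suc m) (deriv01 f)"
          unfolding C_int_Suc[of "Suc m"] by blast+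
        then show ?case using Suc.IH by auto
      qed
      show ?thesis using C * by blast
    qed
    then show "\<forall>m. CH 1 (Suc m) f" by blast
  next
    assume C: "\<forall>m. CH 1 (Suc m) f"
    show "\<forall>r. C_int r f"
    proof
      fix r
      have "CH 1 r f" using C CH_SucD[of 1 r f] by simp
      then show "C_int r f" using C_holder_iff_CH[of 1 r f] by (simp add: C_holder_def)
    qed
  qed
  then show ?thesis using True by (intro that[of "{1} \<times> UNIV"]) (auto simp: C_class_def one_ereal_def)
next
  case False
  then obtain t where t: "s = ereal t" "1 < t" using assms by (cases s) auto
  define n where "n = nat (\<lceil>t\<rceil> - 2)"
  define \<alpha> where "\<alpha> = t - 1 - real n"
  have "1 < \<lceil>t\<rceil>" using t by (simp add: less_ceiling_iff)
  then have n: "int n = \<lceil>t\<rceil> - 2" by (simp add: n_def)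
  then have "real n = of_int \<lceil>t\<rceil> - 2" by linarith
  then have \<alpha>: "0 < \<alpha>" "\<alpha> \<le> 1" unfolding \<alpha>_def using ceiling_correct[of t] by linarith+
  have uniq: "r = Suc n \<and> \<beta> = \<alpha>" if "0 < \<beta>" "\<beta> \<le> 1" "t = real r + \<beta>" for r \<beta>
  proof -
    have "\<lceil>t\<rceil> = int r + 1" using that by (intro ceiling_unique) auto
    then have "r = Suc n" using n by simp
    then show ?thesis using that by (simp add: \<alpha>_def)
  qed
  have "C_class s f \<longleftrightarrow> CH \<alpha> (Suc n) f" for f
  proof -
    have "C_class s f \<longleftrightarrow> (\<exists>r \<beta>. 1 \<le> r \<and> 0 < \<beta> \<and> \<beta> \<le> 1 \<and> t = real r + \<beta> \<and> C_holder r \<beta> f)"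
      using t by (auto simp: C_class_def one_ereal_def)
    also have "\<dots> \<longleftrightarrow> C_holder (Suc n) \<alpha> f"
    proof
      assume "\<exists>r \<beta>. 1 \<le> r \<and> 0 < \<beta> \<and> \<beta> \<le> 1 \<and> t = real r + \<beta> \<and> C_holder r \<beta> f"
      then show "C_holder (Suc n) \<alpha> f" using uniq by blast
    next
      assume "C_holder (Suc n) \<alpha> f"
      moreover have "t = real (Suc n) + \<alpha>" by (simp add: \<alpha>_def)
      ultimately show "\<exists>r \<beta>. 1 \<le> r \<and> 0 < \<beta> \<and> \<beta> \<le> 1 \<and> t = real r + \<beta> \<and> C_holder r \<beta> f"
        using \<alpha> by (intro exI[of _ "Suc n"] exI[of _ \<alpha>]) simp
    qed
    also have "\<dots> \<longleftrightarrow> CH \<alpha> (Suc n) f" by (rule C_holder_iff_CH[OF \<alpha>(1)])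
    finally show ?thesis .
  qed
  then show ?thesis using \<alpha> by (intro that[of "{(\<alpha>, n)}"]) auto
qed

lemma C_int_1_iff: "C_int 1 f \<longleftrightarrow> deriv_on01 f (deriv01 f) \<and> continuous_on {0..1} (deriv01 f)"
  unfolding One_nat_def C_int_Suc by (simp add: C_int_def)

lemma C_int_1I:
  assumes "deriv_on01 f f'" "continuous_on {0..1} f'"
  shows "C_int 1 f"
proof -
  have eq: "f' x = deriv01 f x" if "x \<in> {0..1}" for x using assms(1) that deriv01_eq by metis
  have "deriv_on01 f (deriv01 f)" by (rule deriv_on01_cong[OF assms(1)]) (auto simp: eq)
  moreover have "continuous_on {0..1} (deriv01 f)"
    by (rule continuous_on_eq[OF assms(2) eq])
  ultimately show ?thesis unfolding C_int_1_iff ..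
qed

lemma C_class_imp_C_int_1:
  assumes "C_class s f"
  shows "C_int 1 f"
proof -
  have "C_int r f \<Longrightarrow> 1 \<le> r \<Longrightarrow> C_int 1 f" for r by (auto simp: C_int_def)
  then show ?thesis using assms unfolding C_class_def C_holder_def by blast
qed

lemma C_class_1_iff: "C_class 1 f \<longleftrightarrow> C_int 1 f"
  using C_class_imp_C_int_1 by (auto simp: C_class_def)

text \<open>
  The derivatives do not vanish and \<open>g i 0 < g i 1\<close>, so that they are positive.
\<close>

lemma hyperbolic_diff_ifs:
  assumes "hyperbolic_ifs s g"
  obtains c where "diff_ifs g (\<lambda>i. deriv01 (g i)) c"
proof -
  have C: "deriv_on01 (g i) (deriv01 (g i))" "continuous_on {0..1} (deriv01 (g i))" for i
    using assms C_class_imp_C_int_1 C_int_1_iff unfolding hyperbolic_ifs_def by blast+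
  have bdd: "bdd_above ((\<lambda>t. \<bar>deriv01 (g i) t\<bar>) ` {0..1})" "bdd_below ((\<lambda>t. \<bar>deriv01 (g i) t\<bar>) ` {0..1})" for i
  proof -
    obtain B where "\<And>x. x \<in> {0..1} \<Longrightarrow> \<bar>deriv01 (g i) x\<bar> \<le> B" using bounded_on01[OF C(2)] by metis
    then show "bdd_above ((\<lambda>t. \<bar>deriv01 (g i) t\<bar>) ` {0..1})" by (rule bdd_aboveI2)
    show "bdd_below ((\<lambda>t. \<bar>deriv01 (g i) t\<bar>) ` {0..1})" by (rule bdd_belowI2[of _ 0]) simp
  qed
  define c where "c = max (SUP t\<in>{0..1}. \<bar>deriv01 (g False) t\<bar>) (SUP t\<in>{0..1}. \<bar>deriv01 (g True) t\<bar>)"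
  have c1: "c < 1" using assms by (simp add: c_def hyperbolic_ifs_def)
  have up: "\<bar>deriv01 (g i) x\<bar> \<le> c" if "x \<in> {0..1}" for i x
    using cSUP_upper[OF that bdd(1), of i] by (cases i) (auto simp: c_def)
  have nz: "deriv01 (g i) x \<noteq> 0" if "x \<in> {0..1}" for i x
  proof -
    have "0 < (INF t\<in>{0..1}. \<bar>deriv01 (g i) t\<bar>)" using assms unfolding hyperbolic_ifs_def by blast
    then have "0 < \<bar>deriv01 (g i) x\<bar>" using cINF_lower[OF bdd(2) that, of i] by linarith
    then show ?thesis by simp
  qed
  have incr: "g i 0 < g i 1" for i using assms unfolding hyperbolic_ifs_def by (cases i) auto
  have pos: "0 < deriv01 (g i) x" if x: "x \<in> {0..1}" for i x
  proof (rule ccontr)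
    assume "\<not> 0 < deriv01 (g i) x"
    then have neg: "deriv01 (g i) x \<le> 0" by simp
    have "\<exists>z\<in>{0<..<1}. g i 1 - g i 0 = deriv01 (g i) z * (1 - 0)"
    proof (rule mvt_simple)
      fix z :: real assume "0 \<le> z" "z \<le> 1"
      then show "(g i has_derivative (\<lambda>h. deriv01 (g i) z * h)) (at z within {0..1})"
        using bspec[OF C(1)[of i], of z] by (simp add: has_field_derivative_def)
    qed simp
    then obtain z where "z \<in> {0<..<1}" "g i 1 - g i 0 = deriv01 (g i) z" by auto
    then have z: "z \<in> {0..1}" "0 < deriv01 (g i) z" using incr[of i] by auto
    have "connected (deriv01 (g i) ` {0..1})"
      by (rule connected_continuous_image[OF C(2)]) simp
    then have "0 \<in> deriv01 (g i) ` {0..1}"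
      using connectedD_interval[of _ "deriv01 (g i) x" "deriv01 (g i) z" 0] neg z x by auto
    then show False using nz by force
  qed
  have "diff_ifs g (\<lambda>i. deriv01 (g i)) c"
  proof
    show "g i x \<in> {0..1}" if "x \<in> {0..1}" for i x
      using assms that unfolding hyperbolic_ifs_def by blast
    show "deriv01 (g i) x \<le> c" if "x \<in> {0..1}" for i x using up[OF that, of i] by simp
  qed (use C pos c1 in auto)
  then show ?thesis by (rule that)
qed

section \<open>From the Livsic condition to a pseudo-affine conjugate\<close>

text \<open>
  An increasing diffeomorphism of the unit interval, given by its derivative, and its inverse.
\<close>

lemma diffeo01:
  assumes d: "deriv_on01 H H'" and pos': "\<forall>x\<in>{0..1}. 0 < H' x"
    and ends: "H 0 = 0" "H 1 = 1"
  shows "bij_betw H {0..1} {0..1}"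
    and "\<And>y. y \<in> {0..1} \<Longrightarrow> inv_into {0..1} H y \<in> {0..1}"
    and "\<And>y. y \<in> {0..1} \<Longrightarrow> H (inv_into {0..1} H y) = y"
    and "\<And>x. x \<in> {0..1} \<Longrightarrow> inv_into {0..1} H (H x) = x"
    and "deriv_on01 (inv_into {0..1} H) (\<lambda>y. 1 / H' (inv_into {0..1} H y))"
proof -
  have pos: "0 < H' x" if "x \<in> {0..1}" for x using pos' that by blast
  have mono: "H x < H y" if "x \<in> {0..1}" "y \<in> {0..1}" "x < y" for x y
  proof -
    have "\<exists>z\<in>{x<..<y}. H y - H x = H' z * (y - x)"
    proof (rule mvt_simple[OF that(3)])
      fix z assume "x \<le> z" "z \<le> y"
      then have "(H has_real_derivative H' z) (at z within {0..1})" using d that by auto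
      then have "(H has_real_derivative H' z) (at z within {x..y})"
        by (rule DERIV_subset) (use that in auto)
      then show "(H has_derivative (\<lambda>h. H' z * h)) (at z within {x..y})"
        by (simp add: has_field_derivative_def)
    qed
    then obtain z where z: "z \<in> {x<..<y}" "H y - H x = H' z * (y - x)" by blast
    then have "0 < H' z * (y - x)" using pos[of z] that by auto
    then show ?thesis using z by simp
  qed
  have inj: "inj_on H {0..1}"
    by (rule linorder_inj_onI') (use mono in force)
  have "H ` {0..1} \<subseteq> {0..1}"
  proof (rule image_subsetI)
    fix x :: real assume x: "x \<in> {0..1}"
    have "H 0 \<le> H x" using mono[of 0 x] x by (cases "x = 0") (auto intro: less_imp_le)
    moreover have "H x \<le> H 1" using mono[of x 1] x by (cases "x = 1") (auto intro: less_imp_le)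
    ultimately show "H x \<in> {0..1}" using ends by simp
  qed
  moreover have "{0..1} \<subseteq> H ` {0..1}"
  proof
    fix y :: real assume y: "y \<in> {0..1}"
    have "\<exists>x\<ge>0. x \<le> 1 \<and> H x = y"
      by (rule IVT') (use y ends deriv_on01_cont[OF d] in auto)
    then show "y \<in> H ` {0..1}" by auto
  qed
  ultimately have img: "H ` {0..1} = {0..1}" by blast
  show bij: "bij_betw H {0..1} {0..1}" using inj img by (simp add: bij_betw_def)
  show kmap: "inv_into {0..1} H y \<in> {0..1}" if "y \<in> {0..1}" for y
    using inv_into_into[of y H "{0..1}"] that img by simp
  show Hk: "H (inv_into {0..1} H y) = y" if "y \<in> {0..1}" for y
    using f_inv_into_f[of y H "{0..1}"] that img by simp
  show kH: "inv_into {0..1} H (H x) = x" if "x \<in> {0..1}" for x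
    using inv_into_f_f[OF inj that] .
  have ck: "continuous_on {0..1} (inv_into {0..1} H)"
    using continuous_on_inv[OF deriv_on01_cont[OF d] compact_Icc, of "inv_into {0..1} H"] kH img by simp
  show "deriv_on01 (inv_into {0..1} H) (\<lambda>y. 1 / H' (inv_into {0..1} H y))"
  proof
    fix y :: real assume y: "y \<in> {0..1}"
    define x where "x = inv_into {0..1} H y"
    have x: "x \<in> {0..1}" "H x = y" using kmap Hk y by (auto simp: x_def)
    have nz: "H' x \<noteq> 0" using pos[OF x(1)] by simp
    have "(inv_into {0..1} H has_derivative (\<lambda>h. 1 / H' x * h)) (at (H x) within H ` {0..1})"
    proof (rule has_derivative_inverse_within)
      show "(H has_derivative (\<lambda>h. H' x * h)) (at x within {0..1})"
        using d x(1) by (auto simp: has_field_derivative_def)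
      show "continuous (at (H x) within H ` {0..1}) (inv_into {0..1} H)"
        using ck y unfolding img x(2) continuous_on_eq_continuous_within by blast
      show "linear (\<lambda>h. 1 / H' x * h)" by (intro bounded_linear.linear bounded_linear_mult_right)
      show "(\<lambda>h. 1 / H' x * h) \<circ> (\<lambda>h. H' x * h) = id" using nz by (auto simp: fun_eq_iff)
    qed (use x kH in auto)
    then show "(inv_into {0..1} H has_real_derivative 1 / H' (inv_into {0..1} H y)) (at y within {0..1})"
      unfolding img x(2) unfolding has_field_derivative_def x_def .
  qed
qed

text \<open>
  The transfer operator on densities, which adds the pull-backs of the density under both maps;
  \<open>pull_sum\<close> is the corresponding operator on primitives.
\<close>

definition transfer :: "ifs \<Rightarrow> ifs \<Rightarrow> (real \<Rightarrow> real) \<Rightarrow> real \<Rightarrow> real" where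
  "transfer g D \<rho> x = \<rho> (g False x) * D False x + \<rho> (g True x) * D True x"

definition pull_sum :: "ifs \<Rightarrow> (real \<Rightarrow> real) \<Rightarrow> real \<Rightarrow> real" where
  "pull_sum g h x = h (g False x) + h (g True x)"

context diff_ifs
begin

text \<open>
  A density \<open>\<rho>\<close> on \<open>[0,1]\<close> for which both maps multiply lengths by exactly \<open>l\<close> at the points of the
  form \<open>G\<^sub>w 0\<close>, which are dense in the attractor when \<open>0\<close> is fixed by the first map.
\<close>

definition balanced :: "real \<Rightarrow> (real \<Rightarrow> real) \<Rightarrow> bool" where
  "balanced l \<rho> \<longleftrightarrow> continuous_on {0..1} \<rho> \<and> (\<forall>x\<in>{0..1}. 0 < \<rho> x) \<and>
     (\<forall>w i. \<rho> (g i (word_map g w 0)) * D i (word_map g w 0) = l * \<rho> (word_map g w 0))"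

text \<open>
  If \<open>\<rho>\<close> linearises the first map everywhere, then the distortion of a word \<open>w\<close> at \<open>0\<close> is the limit
  of the distortions at the periodic points of \<open>0\<^sup>n w\<close>, where the Livsic condition makes it trivial.
\<close>

lemma livsic_balanced:
  assumes liv: "livsic l g" and l: "0 < l" and g0: "g False 0 = 0"
    and c: "continuous_on {0..1} \<rho>" and pos: "\<And>x. x \<in> {0..1} \<Longrightarrow> 0 < \<rho> x"
    and eq: "\<And>x. x \<in> {0..1} \<Longrightarrow> \<rho> (g False x) * D False x = l * \<rho> x"
  shows "balanced l \<rho>"
proof -
  have rep: "\<rho> (word_map g (replicate n False) x) * word_deriv g D (replicate n False) x = l ^ n * \<rho> x"
    if "x \<in> {0..1}" for n x
  proof (induction n)
    case (Suc n)
    have "\<rho> (word_map g (replicate (Suc n) False) x) * word_deriv g D (replicate (Suc n) False) x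
      = (\<rho> (g False (word_map g (replicate n False) x)) * D False (word_map g (replicate n False) x))
          * word_deriv g D (replicate n False) x" by simp
    also have "\<dots> = l * (\<rho> (word_map g (replicate n False) x) * word_deriv g D (replicate n False) x)"
      using eq[OF word_maps[OF that]] by simp
    finally show ?case using Suc by simp
  qed simp
  have fixed0: "word_map g (replicate n False) 0 = 0" for n by (induction n) (auto simp: g0)
  have key: "\<rho> (word_map g w 0) * word_deriv g D w 0 = l ^ length w * \<rho> 0" for w
  proof -
    \<comment> \<open>The periodic points of the words \<open>0\<^sup>n w\<close> tend to \<open>0\<close>.\<close>
    define y where "y n = word_fix g (replicate (Suc n) False @ w)" for n
    have y: "y n \<in> {0..1}" "word_map g (replicate (Suc n) False) (word_map g w (y n)) = y n" for n
      using word_fix[of "replicate (Suc n) False @ w"] by (auto simp: y_def simp flip: word_map_append)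
    have bnd: "norm (y n) \<le> c ^ Suc n" for n
      using word_close[OF word_maps[OF y(1)], of 0 "replicate (Suc n) False" w n] fixed0[of "Suc n"] y(2)[of n]
      by (simp del: replicate_Suc word_map_Cons)
    have "(\<lambda>n. c ^ Suc n) \<longlonglongrightarrow> 0"
      by (rule LIMSEQ_Suc) (rule LIMSEQ_realpow_zero[OF c_nonneg c_less])
    then have "y \<longlonglongrightarrow> 0"
      by (rule Lim_null_comparison[rotated]) (rule always_eventually, rule allI, rule bnd)
    have yeq: "\<rho> (word_map g w (y n)) * word_deriv g D w (y n) = l ^ length w * \<rho> (y n)" for n
    proof -
      let ?r = "replicate (Suc n) False"
      have "word_deriv g D (?r @ w) (y n) = l ^ length (?r @ w)"
        unfolding y_def by (rule liv[unfolded livsic_iff, rule_format]) simp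
      then have 1: "word_deriv g D ?r (word_map g w (y n)) * word_deriv g D w (y n) = l ^ Suc n * l ^ length w"
        by (simp add: word_deriv_append power_add del: replicate_Suc word_deriv.simps)
      have 2: "\<rho> (y n) * word_deriv g D ?r (word_map g w (y n)) = l ^ Suc n * \<rho> (word_map g w (y n))"
        using rep[OF word_maps[OF y(1)], of "Suc n" w n] y(2)[of n] by simp
      have "\<rho> (y n) * (l ^ Suc n * l ^ length w)
          = l ^ Suc n * \<rho> (word_map g w (y n)) * word_deriv g D w (y n)"
        unfolding 1[symmetric] 2[symmetric] by (simp only: mult.assoc)
      then show ?thesis using l by (simp add: mult.commute)
    qed
    have "continuous_on {0..1} (\<lambda>x. \<rho> (word_map g w x))"
      by (rule continuous_on_compose2[OF c deriv_on01_cont[OF word_deriv]]) (use word_maps in blast)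
    then have "continuous_on {0..1} (\<lambda>x. \<rho> (word_map g w x) * word_deriv g D w x - l ^ length w * \<rho> x)"
      by (intro continuous_intros word_deriv_cont c)
    from continuous_on_tendsto_compose[OF this \<open>y \<longlonglongrightarrow> 0\<close>] y(1)
    have "(\<lambda>n. \<rho> (word_map g w (y n)) * word_deriv g D w (y n) - l ^ length w * \<rho> (y n))
        \<longlonglongrightarrow> \<rho> (word_map g w 0) * word_deriv g D w 0 - l ^ length w * \<rho> 0" by simp
    then have "\<rho> (word_map g w 0) * word_deriv g D w 0 - l ^ length w * \<rho> 0 = 0"
      by (simp add: yeq LIMSEQ_const_iff)
    then show ?thesis by simp
  qed
  have "\<rho> (g i (word_map g w 0)) * D i (word_map g w 0) = l * \<rho> (word_map g w 0)" for w i
  proof -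
    have "(\<rho> (g i (word_map g w 0)) * D i (word_map g w 0)) * word_deriv g D w 0
        = (l * \<rho> (word_map g w 0)) * word_deriv g D w 0"
      unfolding mult.assoc[of l] key[of w] using key[of "i # w"] by simp
    then show ?thesis using word_deriv_pos[of 0 w] by simp
  qed
  then show ?thesis using c pos unfolding balanced_def by blast
qed

lemma g_cont: "continuous_on {0..1} (g i)"
  by (rule cont)

lemma comp_g_cont: "continuous_on {0..1} \<rho> \<Longrightarrow> continuous_on {0..1} (\<lambda>x. \<rho> (g i x))"
  by (rule continuous_on_compose2[OF _ g_cont]) (use g_maps in auto)

lemma transfer_pos:
  assumes "\<And>x. x \<in> {0..1} \<Longrightarrow> 0 < \<rho> x" "x \<in> {0..1}"
  shows "0 < transfer g D \<rho> x"
  unfolding transfer_def using assms g_maps D_pos by (intro add_pos_pos mult_pos_pos) blast+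

lemma balanced_transfer:
  assumes "balanced l \<rho>"
  shows "balanced l (transfer g D \<rho>)"
proof -
  have b: "\<rho> (g i (word_map g w 0)) * D i (word_map g w 0) = l * \<rho> (word_map g w 0)" for w i
    using assms unfolding balanced_def by blast
  have t: "transfer g D \<rho> (word_map g w 0) = 2 * l * \<rho> (word_map g w 0)" for w
    unfolding transfer_def b by simp
  have "transfer g D \<rho> (g i (word_map g w 0)) * D i (word_map g w 0) = l * transfer g D \<rho> (word_map g w 0)" for i w
    using t[of "i # w"] t[of w] b[of i w] by (simp add: mult.assoc)
  moreover have "continuous_on {0..1} (transfer g D \<rho>)"
    using assms unfolding transfer_def[abs_def] balanced_def
    by (intro continuous_intros comp_g_cont D_cont) auto
  moreover have "0 < transfer g D \<rho> x" if "x \<in> {0..1}" for x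
    using transfer_pos assms that unfolding balanced_def by blast
  ultimately show ?thesis unfolding balanced_def by blast
qed

lemma deriv_pull_sum:
  assumes "deriv_on01 h \<rho>"
  shows "deriv_on01 (pull_sum g h) (transfer g D \<rho>)"
proof
  fix x :: real assume x: "x \<in> {0..1}"
  have "((\<lambda>x. h (g i x)) has_real_derivative \<rho> (g i x) * D i x) (at x within {0..1})" for i
    using deriv_on01_comp[OF assms g_deriv g_maps] x by blast
  then show "(pull_sum g h has_real_derivative transfer g D \<rho> x) (at x within {0..1})"
    unfolding pull_sum_def[abs_def] transfer_def by (intro DERIV_add)
qed

lemma CH_comp_g:
  assumes "0 < \<alpha>" "\<alpha> \<le> 1" "CH \<alpha> m h" "CH \<alpha> m (g i)"
  shows "CH \<alpha> m (\<lambda>x. h (g i x))"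
  by (rule CH_comp[OF assms g_maps lip])

lemma transfer_iterates_mono:
  assumes "\<And>w x. length w = n \<Longrightarrow> x \<in> {0..1} \<Longrightarrow> \<sigma> (word_map g w x) \<le> \<kappa> * \<rho> (word_map g w x)"
    and "x \<in> {0..1}"
  shows "(transfer g D ^^ n) \<sigma> x \<le> \<kappa> * (transfer g D ^^ n) \<rho> x"
  using assms
proof (induction n arbitrary: \<sigma> \<rho> x)
  case 0
  then show ?case using "0.prems"(1)[of "[]" x] by simp
next
  case (Suc n)
  have "transfer g D \<sigma> (word_map g w x) \<le> \<kappa> * transfer g D \<rho> (word_map g w x)"
    if "length w = n" "x \<in> {0..1}" for w x
  proof -
    have "\<sigma> (g i (word_map g w x)) * D i (word_map g w x)
        \<le> \<kappa> * \<rho> (g i (word_map g w x)) * D i (word_map g w x)" for i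
      using Suc.prems(1)[of "i # w" x] that D_pos[OF word_maps[OF that(2)], of i w]
      by (intro mult_right_mono) (auto intro: less_imp_le)
    from add_mono[OF this[of False] this[of True]] show ?thesis
      unfolding transfer_def by (simp add: algebra_simps)
  qed
  from Suc.IH[of "transfer g D \<sigma>" "transfer g D \<rho>", OF this Suc.prems(2)] show ?case
    by (simp add: funpow_Suc_right del: funpow.simps)
qed

text \<open>
  On the images of all words of a sufficiently large length, both maps contract the lengths measured by
  \<open>\<rho>\<close> by a factor below \<open>1/2\<close>. Averaging over these words makes both maps contractions everywhere, at
  the cost of doubling the factor.
\<close>

lemma contracted_density:
  assumes bal: "balanced l \<rho>" and l: "l < 1/2"
  obtains n \<kappa> where "\<kappa> < 1"
    "\<And>x i. x \<in> {0..1} \<Longrightarrow> (transfer g D ^^ n) \<rho> (g i x) * D i x \<le> \<kappa> * (transfer g D ^^ n) \<rho> x"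
proof -
  have c\<rho>: "continuous_on {0..1} \<rho>" and pos: "\<And>x. x \<in> {0..1} \<Longrightarrow> 0 < \<rho> x"
    and b: "\<And>w i. \<rho> (g i (word_map g w 0)) * D i (word_map g w 0) = l * \<rho> (word_map g w 0)"
    using bal unfolding balanced_def by blast+
  define R where "R i x = \<rho> (g i x) * D i x / \<rho> x" for i x
  have cR: "continuous_on {0..1} (R i)" for i
    unfolding R_def[abs_def] using pos by (intro continuous_intros comp_g_cont D_cont c\<rho>) force
  \<comment> \<open>Any number strictly between \<open>l\<close> and \<open>1/2\<close> would do.\<close>
  define \<mu> where "\<mu> = (l + 1/2) / 2"
  have \<mu>: "0 < \<mu> - l" "2 * \<mu> < 1" using l by (auto simp: \<mu>_def)
  have "\<exists>\<delta>>0. \<forall>x\<in>{0..1}. \<forall>y\<in>{0..1}. dist y x < \<delta> \<longrightarrow> dist (R i y) (R i x) < \<mu> - l" for i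
    using compact_uniformly_continuous[OF cR compact_Icc] \<mu>(1) unfolding uniformly_continuous_on_def by blast
  then obtain \<delta> where \<delta>: "\<And>i. \<delta> i > 0"
    "\<And>i x y. x \<in> {0..1} \<Longrightarrow> y \<in> {0..1} \<Longrightarrow> dist y x < \<delta> i \<Longrightarrow> dist (R i y) (R i x) < \<mu> - l"
    by metis
  obtain n where n: "c ^ n < min (\<delta> False) (\<delta> True)"
    using real_arch_pow_inv[of "min (\<delta> False) (\<delta> True)" c] \<delta>(1) c_less by auto
  have near: "\<rho> (g i (word_map g w x)) * D i (word_map g w x) \<le> \<mu> * \<rho> (word_map g w x)"
    if w: "length w = n" and x: "x \<in> {0..1}" for w x i
  proof -
    have m: "word_map g w x \<in> {0..1}" "word_map g w 0 \<in> {0..1}" using word_maps x by auto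
    have "dist (word_map g w x) (word_map g w 0) < \<delta> i"
      using word_close[OF x, of 0 w] n w by (cases i) (auto simp: dist_real_def)
    from \<delta>(2)[OF m(2,1) this] have "R i (word_map g w x) < R i (word_map g w 0) + (\<mu> - l)"
      by (simp add: dist_real_def abs_less_iff)
    moreover have "R i (word_map g w 0) = l" using b[of i w] pos[OF m(2)] by (simp add: R_def)
    ultimately have "R i (word_map g w x) \<le> \<mu>" by linarith
    then show ?thesis using pos[OF m(1)] by (simp add: R_def divide_le_eq)
  qed
  have pos_n: "0 < (transfer g D ^^ n) \<rho> x" if "x \<in> {0..1}" for n x
    using that by (induction n arbitrary: x) (auto intro: transfer_pos pos simp del: atLeastAtMost_iff)
  show ?thesis
  proof (rule that[of "2 * \<mu>" n])
    fix x :: real and i assume x: "x \<in> {0..1}"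
    have "transfer g D \<rho> (word_map g w y) \<le> 2 * \<mu> * \<rho> (word_map g w y)"
      if "length w = n" "y \<in> {0..1}" for w y
      using near[OF that, of False] near[OF that, of True] unfolding transfer_def by simp
    from transfer_iterates_mono[of n "transfer g D \<rho>" "2 * \<mu>" \<rho>, OF this x]
    have "transfer g D ((transfer g D ^^ n) \<rho>) x \<le> 2 * \<mu> * (transfer g D ^^ n) \<rho> x"
      by (simp add: funpow_swap1)
    moreover have "(transfer g D ^^ n) \<rho> (g i x) * D i x \<le> transfer g D ((transfer g D ^^ n) \<rho>) x"
    proof -
      have "0 < (transfer g D ^^ n) \<rho> (g j x) * D j x" for j
        by (intro mult_pos_pos pos_n g_maps D_pos x)
      from less_imp_le[OF this] show ?thesis unfolding transfer_def[of _ _ _ x]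
        by (cases i) (auto simp: add_increasing add_increasing2)
    qed
    ultimately show "(transfer g D ^^ n) \<rho> (g i x) * D i x \<le> 2 * \<mu> * (transfer g D ^^ n) \<rho> x"
      by linarith
  qed (use \<mu> in simp)
qed

end

text \<open>
  The conjugacy is the normalised primitive of the averaged linearising density of the first map.
\<close>

lemma livsic_imp_pseudo_affine:
  assumes s: "1 < s" and hyp: "hyperbolic_ifs s g" and l: "0 < l" "l < 1/2" and liv: "livsic l g"
  shows "\<exists>f. pseudo_affine_slope l f \<and> (\<forall>i. C_class s (f i)) \<and> C_conjugate s g f"
proof -
  define D where "D = (\<lambda>i. deriv01 (g i))"
  obtain c where "diff_ifs g D c" using hyperbolic_diff_ifs[OF hyp] unfolding D_def by blast
  then interpret diff_ifs g D c .
  have g0: "g False 0 = 0" using hyp by (simp add: hyperbolic_ifs_def)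
  obtain J where J: "J \<noteq> {}" "\<And>\<alpha> m. (\<alpha>, m) \<in> J \<Longrightarrow> 0 < \<alpha> \<and> \<alpha> \<le> (1::real)"
    and C: "\<And>f. C_class s f \<longleftrightarrow> (\<forall>(\<alpha>, m)\<in>J. CH \<alpha> (Suc m) f)" using C_class_CH[OF s] by metis
  have gCH: "CH \<alpha> (Suc m) (g i)" if "(\<alpha>, m) \<in> J" for \<alpha> m i
    using hyp C that unfolding hyperbolic_ifs_def by blast
  obtain \<alpha>0 m0 where J0: "(\<alpha>0, m0) \<in> J" using J(1) by auto
  have \<alpha>0: "0 < \<alpha>0" "\<alpha>0 \<le> 1" using J(2) J0 by auto
  interpret g0: contraction01 "g False" "D False" c
    by unfold_locales (use g_maps g_deriv D_abs c_less_1 g0 in auto)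
  have "D False 0 = l"
  proof -
    have "word_fix g [False] = 0" by (rule word_fix_eqI) (auto simp: g0)
    moreover have "word_deriv g D [False] (word_fix g [False]) = l ^ length [False]"
      by (rule liv[unfolded livsic_iff, rule_format]) simp
    ultimately show ?thesis by simp
  qed
  moreover have "CH \<alpha>0 (Suc 0) (g False)" by (rule CH_mono[OF \<alpha>0 _ gCH[OF J0]]) simp
  ultimately obtain \<rho> where \<rho>: "continuous_on {0..1} \<rho>" "\<And>x. x \<in> {0..1} \<Longrightarrow> 0 < \<rho> x"
    "\<And>x. x \<in> {0..1} \<Longrightarrow> \<rho> (g False x) * D False x = l * \<rho> x"
    and \<rho>CH: "\<And>\<alpha> m. 0 < \<alpha> \<Longrightarrow> \<alpha> \<le> 1 \<Longrightarrow> CH \<alpha> (Suc m) (g False) \<Longrightarrow> CH \<alpha> m \<rho>"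
    using g0.koenigs_density[OF D_pos _ \<alpha>0] by metis
  define h where "h x = integral {0..x} \<rho>" for x
  have dh: "deriv_on01 h \<rho>"
    unfolding h_def[abs_def] using integral_has_real_derivative[OF \<rho>(1)] by blast
  have hCH: "CH \<alpha> (Suc m) h" if "(\<alpha>, m) \<in> J" for \<alpha> m
    using CH_SucI[OF dh \<rho>CH] J(2)[OF that] gCH[OF that] by blast
  have bal: "balanced l \<rho>" by (rule livsic_balanced[OF liv l(1) g0 \<rho>])
  obtain n \<kappa> where \<kappa>: "\<kappa> < 1" and
    contr: "\<And>x i. x \<in> {0..1} \<Longrightarrow> (transfer g D ^^ n) \<rho> (g i x) * D i x \<le> \<kappa> * (transfer g D ^^ n) \<rho> x"
    using contracted_density[OF bal l(2)] by metis
  define p where "p = (transfer g D ^^ n) \<rho>"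
  define q where "q = (pull_sum g ^^ n) h"
  have balp: "balanced l p" unfolding p_def
    by (induction n) (use bal balanced_transfer in auto)
  then have cp: "continuous_on {0..1} p" and pp: "\<And>x. x \<in> {0..1} \<Longrightarrow> 0 < p x"
    and bp: "\<And>w i. p (g i (word_map g w 0)) * D i (word_map g w 0) = l * p (word_map g w 0)"
    unfolding balanced_def by blast+
  have dq: "deriv_on01 q p" unfolding q_def p_def
    by (induction n) (use dh deriv_pull_sum in auto)
  have qCH: "CH \<alpha> (Suc m) q" if "(\<alpha>, m) \<in> J" for \<alpha> m
  proof -
    have \<alpha>: "0 < \<alpha>" "\<alpha> \<le> 1" using J(2)[OF that] by auto
    show ?thesis unfolding q_def
    proof (induction n)
      case (Suc n)
      from CH_add[OF CH_comp_g[OF \<alpha> Suc gCH[OF that]] CH_comp_g[OF \<alpha> Suc gCH[OF that]]]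
      show ?case by (simp add: pull_sum_def[abs_def])
    qed (use hCH[OF that] in simp)
  qed
  define b where "b = q 1 - q 0"
  have b: "0 < b"
  proof -
    have "\<exists>z\<in>{0<..<1}. q 1 - q 0 = p z * (1 - 0)"
    proof (rule mvt_simple)
      fix z :: real assume "0 \<le> z" "z \<le> 1"
      then show "(q has_derivative (\<lambda>h. p z * h)) (at z within {0..1})"
        using bspec[OF dq, of z] by (simp add: has_field_derivative_def)
    qed simp
    then obtain z where z: "z \<in> {0<..<1}" "q 1 - q 0 = p z" by auto
    then have "0 < p z" by (intro pp) auto
    then show ?thesis using z by (simp add: b_def)
  qed
  define H where "H x = (q x + (- q 0)) * (1 / b)" for x
  define H' where "H' x = p x / b" for x
  have dH: "deriv_on01 H H'"
  proof
    fix x :: real assume "x \<in> {0..1}"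
    then have "(q has_real_derivative p x) (at x within {0..1})" using dq by blast
    from DERIV_cmult_right[OF DERIV_add[OF this DERIV_const[of "- q 0"]], of "1 / b"]
    show "(H has_real_derivative H' x) (at x within {0..1})"
      by (simp add: H_def[abs_def] H'_def)
  qed
  have posH: "0 < H' x" if "x \<in> {0..1}" for x using pp[OF that] b by (simp add: H'_def)
  have ends: "H 0 = 0" "H 1 = 1" using b by (auto simp: H_def b_def)
  define k where "k = inv_into {0..1} H"
  have "\<forall>x\<in>{0..1}. 0 < H' x" using posH by blast
  note diffeo = diffeo01[OF dH this ends, folded k_def]
  have HCH: "CH \<alpha> (Suc m) H" if "(\<alpha>, m) \<in> J" for \<alpha> m
  proof -
    have \<alpha>: "0 < \<alpha>" "\<alpha> \<le> 1" using J(2)[OF that] by auto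
    show ?thesis unfolding H_def[abs_def]
      by (rule CH_mult[OF \<alpha> CH_add[OF qCH[OF that] CH_const] CH_const])
  qed
  have kCH: "CH \<alpha> (Suc m) k" if "(\<alpha>, m) \<in> J" for \<alpha> m
    using CH_inv[OF _ _ HCH[OF that] dH posH diffeo(2,5)] J(2)[OF that] by blast
  have Hmap: "H x \<in> {0..1}" if "x \<in> {0..1}" for x
    using diffeo(1) that by (rule bij_betwE[THEN bspec])
  define f where "f i = H \<circ> g i \<circ> k" for i
  define F where "F i y = p (g i (k y)) * D i (k y) / p (k y)" for i y
  have fmap: "f i y \<in> {0..1}" if "y \<in> {0..1}" for i y
    unfolding f_def o_apply by (intro Hmap g_maps diffeo(2) that)
  have dF: "deriv_on01 (f i) (F i)" for i
  proof -
    have "deriv_on01 (\<lambda>y. H (g i (k y))) (\<lambda>y. H' (g i (k y)) * D i (k y) * (1 / H' (k y)))"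
      using deriv_on01_comp[OF deriv_on01_comp[OF dH g_deriv g_maps] diffeo(5,2)] .
    then show ?thesis
      by (rule deriv_on01_cong) (use b in \<open>auto simp: f_def F_def H'_def\<close>)
  qed
  have Fpos: "0 < F i y" if "y \<in> {0..1}" for i y
    unfolding F_def by (intro divide_pos_pos mult_pos_pos pp D_pos g_maps diffeo(2) that)
  have Fle: "F i y \<le> \<kappa>" if "y \<in> {0..1}" for i y
    using contr[OF diffeo(2)[OF that], of i] pp[OF diffeo(2)[OF that]]
    unfolding F_def p_def[symmetric] by (simp add: divide_le_eq mult.commute)
  have ck: "continuous_on {0..1} k" using diffeo(5) by (rule deriv_on01_cont)
  have cF: "continuous_on {0..1} (F i)" for i
  proof -
    have "continuous_on {0..1} (\<lambda>x. p (g i x) * D i x / p x)"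
      using pp by (intro continuous_intros comp_g_cont D_cont cp) force
    then show ?thesis unfolding F_def[abs_def]
      by (rule continuous_on_compose2[OF _ ck]) (use diffeo(2) in auto)
  qed
  interpret f: diff_ifs f F \<kappa>
    by unfold_locales (use fmap dF cF Fpos Fle \<kappa> in auto)
  have word_f: "word_map f w (H x) = H (word_map g w x)" if "x \<in> {0..1}" for w x
    by (induction w) (use diffeo(4)[OF word_maps[OF that]] in \<open>auto simp: f_def\<close>)
  have Fl: "F i (word_map f w 0) = l" for i w
  proof -
    have "word_map f w 0 = H (word_map g w 0)" using word_f[of 0 w] ends by simp
    then have "k (word_map f w 0) = word_map g w 0" using diffeo(4)[OF word_maps[of 0 w]] by simp
    then show ?thesis using bp[of i w] pp[OF word_maps[of 0 w]] by (simp add: F_def)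
  qed
  have Fatt: "F i x = l" if x: "x \<in> attractor f" for i x
  proof -
    have xI: "x \<in> {0..1}" using x f.invariant_attractor unfolding f.invariant_compact_def by blast
    have "\<exists>w. \<bar>x - word_map f w 0\<bar> \<le> \<kappa> ^ n" for n using f.attractor_approx[OF x, of 0 n] by auto
    then obtain w where w: "\<And>n. \<bar>x - word_map f (w n) 0\<bar> \<le> \<kappa> ^ n" by metis
    have "(\<lambda>n. word_map f (w n) 0 - x) \<longlonglongrightarrow> 0"
      by (rule Lim_null_comparison[OF _ LIMSEQ_realpow_zero[OF f.c_nonneg f.c_less]])
        (use w in \<open>auto simp: abs_minus_commute\<close>)
    then have "(\<lambda>n. word_map f (w n) 0) \<longlonglongrightarrow> x" by (rule LIM_zero_cancel)
    from continuous_on_tendsto_compose[OF cF this xI] f.word_maps[of 0]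
    have "(\<lambda>n. F i (word_map f (w n) 0)) \<longlonglongrightarrow> F i x" by simp
    then show ?thesis by (simp add: Fl LIMSEQ_const_iff)
  qed
  have dfF: "deriv01 (f i) y = F i y" if "y \<in> {0..1}" for i y
    using dF that by (intro deriv01_eq) blast+
  have "contractive_ifs f"
  proof -
    have "C_class 1 (f i)" for i using C_int_1I[OF dF cF] by (simp add: C_class_1_iff)
    moreover have "\<kappa>-lipschitz_on {0..1} (f i)" for i
      using f.lip f.c_nonneg by (intro lipschitz_onI) (auto simp: dist_real_def)
    ultimately show ?thesis
      using fmap \<kappa> dfF Fpos unfolding contractive_ifs_def by (metis image_subsetI less_irrefl)
  qed
  moreover have "deriv01 (f i) x = l" if "x \<in> attractor f" for i x
  proof -
    have "x \<in> {0..1}" using that f.invariant_attractor unfolding f.invariant_compact_def by blast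
    then show ?thesis using dfF Fatt[OF that] by simp
  qed
  ultimately have "pseudo_affine_slope l f" unfolding pseudo_affine_slope_def by blast
  moreover have "C_class s (f i)" for i
  proof -
    have "CH \<alpha> (Suc m) (f i)" if "(\<alpha>, m) \<in> J" for \<alpha> m
    proof -
      have \<alpha>: "0 < \<alpha>" "\<alpha> \<le> 1" using J(2)[OF that] by auto
      have "continuous_on {0..1} (\<lambda>y. 1 / H' (k y))"
        using CH_cont[OF \<alpha>(1)] kCH[OF that] CH_Suc_iff[OF diffeo(5)] by blast
      then obtain B where "\<And>y. y \<in> {0..1} \<Longrightarrow> \<bar>1 / H' (k y)\<bar> \<le> B" using bounded_on01 by metis
      from deriv_on01_lipschitz[OF diffeo(5) this]
      have "CH \<alpha> (Suc m) (\<lambda>y. H (g i (k y)))"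
        by (intro CH_comp[OF \<alpha> CH_comp_g[OF \<alpha> HCH[OF that] gCH[OF that]] kCH[OF that] diffeo(2)])
      then show ?thesis by (simp add: f_def o_def)
    qed
    then show ?thesis unfolding C by blast
  qed
  moreover have "C_conjugate s g f"
  proof -
    have "C_diffeo s H" unfolding C_diffeo_def C k_def[symmetric] using diffeo(1) HCH kCH by blast
    then show ?thesis unfolding C_conjugate_def f_def k_def by blast
  qed
  ultimately show ?thesis by blast
qed

section \<open>Rapidly varying weights with slow variation along the dynamics\<close>

text \<open>The affine model, with ratio \<open>1/4\<close> and images \<open>[0,1/4]\<close> and \<open>[3/4,1]\<close>.\<close>

definition aff :: ifs where
  "aff i x = x / 4 + (if i then 3 / 4 else 0)"

lemma aff_maps: "x \<in> {0..1} \<Longrightarrow> aff i x \<in> {0..1}"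
  by (auto simp: aff_def)

text \<open>
  In the coding of the attractor of \<open>aff\<close> by binary sequences, \<open>run_weight L x\<close> is comparable to
  \<open>4\<^sup>-\<^sup>M\<close>, where \<open>M\<close> is the largest value of \<open>min (L - j) n\<close> over all blocks of \<open>n\<close> consecutive zeros
  starting after \<open>j < L\<close> digits: a long run of zeros counts fully at the beginning and not at all
  beyond position \<open>L\<close>. The recursion compares the run at the beginning of \<open>x\<close> with the runs of its
  images \<open>4 x\<close> and \<open>4 x - 3\<close> under the inverse branches, which have one digit less.
\<close>

primrec run_weight :: "nat \<Rightarrow> real \<Rightarrow> real" where
  "run_weight 0 x = 1"
| "run_weight (Suc L) x =
     min ((1/4) ^ Suc L + \<bar>x\<bar>) (min (run_weight L (4 * x)) (run_weight L (4 * x - 3)))"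

lemma run_weight_pos: "0 < run_weight L x"
  by (induction L arbitrary: x) (auto intro: add_pos_nonneg)

lemma run_weight_le_1: "run_weight L x \<le> 1"
  by (induction L arbitrary: x) (auto simp: min_le_iff_disj)

lemma run_weight_Suc_le: "run_weight (Suc L) x \<le> run_weight L x"
proof (induction L arbitrary: x)
  case 0
  show ?case using run_weight_le_1[of "Suc 0" x] by simp
next
  case (Suc L)
  show ?case
    unfolding run_weight.simps(2)[of "Suc L" x] run_weight.simps(2)[of L x]
    by (intro min.mono Suc.IH) simp
qed

lemma run_weight_le_Suc: "run_weight L x \<le> 4 * run_weight (Suc L) x"
proof (induction L arbitrary: x)
  case 0
  show ?case by (simp add: min_def)
next
  case (Suc L)
  have aux: "min p (min a b) \<le> 4 * min p' (min a' b')" if "p \<le> 4 * p'" "a \<le> 4 * a'" "b \<le> 4 * b'"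
    for p a b p' a' b' :: real using that by (auto simp: min_def)
  show ?case
    unfolding run_weight.simps(2)[of "Suc L" x] run_weight.simps(2)[of L x]
    by (intro aux Suc.IH) simp
qed

lemma run_weight_outside: "1 \<le> x \<or> x \<le> -1 \<Longrightarrow> run_weight L x = 1"
proof (induction L arbitrary: x)
  case (Suc L)
  have "run_weight L (4 * x) = 1" "run_weight L (4 * x - 3) = 1" using Suc.prems by (auto intro!: Suc.IH)
  moreover have "1 \<le> (1/4) ^ Suc L + \<bar>x\<bar>" using Suc.prems by (auto intro: add_increasing)
  ultimately show ?case by simp
qed simp

lemma run_weight_neg: "y \<le> 0 \<Longrightarrow> min 1 (- y) \<le> run_weight L y"
proof (induction L arbitrary: y)
  case (Suc L)
  have "min 1 (- y) \<le> run_weight L (4 * y)" using Suc.IH[of "4 * y"] Suc.prems by linarith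
  moreover have "min 1 (- y) \<le> run_weight L (4 * y - 3)"
    using run_weight_outside[of "4 * y - 3" L] Suc.prems by simp
  moreover have "min 1 (- y) \<le> (1/4) ^ Suc L + \<bar>y\<bar>" using Suc.prems by (auto intro: min.coboundedI2 add_increasing)
  ultimately show ?case by simp
qed simp

lemma run_weight_gap:
  assumes "1/4 \<le> x" "x \<le> 3/4"
  shows "min (1/4) (3 - 4 * x) \<le> run_weight L x"
proof (cases L)
  case (Suc n)
  have "run_weight n (4 * x) = 1" using assms by (intro run_weight_outside) auto
  moreover have "min (1/4) (3 - 4 * x) \<le> run_weight n (4 * x - 3)"
    using run_weight_neg[of "4 * x - 3" n] assms by linarith
  moreover have "1/4 \<le> (1/4) ^ Suc n + \<bar>x\<bar>" using assms by (intro add_increasing) auto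
  ultimately show ?thesis unfolding Suc run_weight.simps(2) by linarith
qed simp

lemma run_weight_aff_le: "run_weight L (aff i x) \<le> 4 * run_weight L x"
proof (cases L)
  case (Suc n)
  have "run_weight L (aff i x) \<le> run_weight n x"
    using Suc by (cases i) (auto simp: aff_def algebra_simps)
  then show ?thesis using run_weight_le_Suc[of n x] Suc by simp
qed simp

text \<open>
  Together with the previous lemma: one step of the dynamics changes the weight by a factor of at
  most \<open>4\<close>, uniformly in \<open>L\<close>.
\<close>

lemma run_weight_le_aff:
  assumes "x \<in> {0..1}"
  shows "run_weight L x \<le> 4 * run_weight L (aff i x)"
proof (cases L)
  case (Suc n)
  have 1: "run_weight (Suc n) x \<le> run_weight n x" by (rule run_weight_Suc_le)
  have 2: "run_weight (Suc n) x \<le> 1" by (rule run_weight_le_1)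
  have 3: "run_weight (Suc n) x \<le> (1/4) ^ Suc n + x"
    unfolding run_weight.simps(2) using assms by (intro min.coboundedI1) simp
  have pos: "0 < run_weight n x" by (rule run_weight_pos)
  show ?thesis
  proof (cases i)
    case True
    have "run_weight n (4 * aff i x) = 1" using assms True by (intro run_weight_outside) (auto simp: aff_def)
    moreover have "4 * aff i x - 3 = x" using True by (simp add: aff_def algebra_simps)
    moreover have "1/4 \<le> (1/4) ^ Suc n + \<bar>aff i x\<bar>" using assms True by (intro add_increasing) (auto simp: aff_def)
    ultimately have "run_weight (Suc n) (aff i x) = min ((1/4) ^ Suc n + \<bar>aff i x\<bar>) (min 1 (run_weight n x))"
      "1/4 \<le> (1/4) ^ Suc n + \<bar>aff i x\<bar>" by (simp_all only: run_weight.simps)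
    then show ?thesis unfolding Suc using 1 2 pos by linarith
  next
    case False
    have "run_weight n (4 * aff i x - 3) = 1" using assms False by (intro run_weight_outside) (auto simp: aff_def)
    moreover have "4 * aff i x = x" using False by (simp add: aff_def)
    moreover have "(1/4) ^ Suc n + \<bar>aff i x\<bar> = ((1/4) ^ n + x) / 4" using assms False by (auto simp: aff_def)
    ultimately have "run_weight (Suc n) (aff i x) = min (((1/4) ^ n + x) / 4) (min (run_weight n x) 1)"
      by (simp only: run_weight.simps)
    moreover have "(1/4 :: real) ^ Suc n \<le> (1/4) ^ n" by (rule power_decreasing) auto
    then have "run_weight (Suc n) x \<le> (1/4) ^ n + x" using 3 by linarith
    moreover have aux: "R \<le> 4 * min (p / 4) (min r 1)" if "R \<le> p" "R \<le> r" "R \<le> 1" "0 < r" for R p r :: real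
      using that by (auto simp: min_def)
    ultimately show ?thesis unfolding Suc using 1 2 pos by metis
  qed
qed simp

lemma run_weight_power_le: "run_weight L ((1/4) ^ n) \<le> (1/4) ^ L + (1/4) ^ n"
  by (cases L) auto

lemma run_weight_cont: "continuous_on S (run_weight L)"
proof -
  have "continuous_on UNIV (run_weight L)"
  proof (induction L)
    case (Suc L)
    have "continuous_on UNIV (\<lambda>x. run_weight L (4 * x))" "continuous_on UNIV (\<lambda>x. run_weight L (4 * x - 3))"
      by (auto intro!: continuous_on_compose2[OF Suc] continuous_intros)
    then show ?case unfolding run_weight.simps(2)[abs_def] by (intro continuous_intros)
  qed simp
  then show ?thesis using continuous_on_subset by blast
qed

text \<open>
  Partial sums of the logarithms of the weights at the scales \<open>L = 4\<^sup>j\<close>, with coefficients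
  \<open>2\<^sup>-\<^sup>j\<^sup>-\<^sup>2\<close>. Along the dynamics each logarithm varies by at most \<open>ln 4\<close>, so that the increments
  converge uniformly; at \<open>0\<close> the sums tend to \<open>-\<infinity>\<close>, because \<open>ln (run_weight L 0)\<close> is about
  \<open>- L ln 4\<close> and \<open>4\<^sup>j\<close> outweighs the coefficients.
\<close>

definition log_sum :: "nat \<Rightarrow> real \<Rightarrow> real" where
  "log_sum N x = (\<Sum>j<N. (1/2) ^ (j + 2) * ln (run_weight (4 ^ j) x))"

lemma coeff_sum_le: "(\<Sum>j<N. (1/2::real) ^ (j + 2)) \<le> 1/2"
proof -
  have "(\<Sum>j<N. (1/2::real) ^ (j + 2)) = 1/2 - (1/2) ^ (N + 1)"
    by (induction N) (auto simp: field_simps)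
  then show ?thesis by simp
qed

lemma ln_run_weight_le_0: "ln (run_weight L x) \<le> 0"
  using run_weight_pos[of L x] run_weight_le_1[of L x] by simp

lemma log_sum_decreasing: "log_sum (Suc N) x \<le> log_sum N x"
  using ln_run_weight_le_0[of "4 ^ N" x] by (simp add: log_sum_def mult_nonneg_nonpos)

lemma log_sum_le_0: "log_sum N x \<le> 0"
  unfolding log_sum_def by (intro sum_nonpos mult_nonneg_nonpos ln_run_weight_le_0) auto

lemma log_sum_cont: "continuous_on S (log_sum N)"
  unfolding log_sum_def[abs_def]
  by (intro continuous_intros run_weight_cont) (use run_weight_pos in \<open>auto simp: less_imp_neq[symmetric]\<close>)

lemma log_increment_le:
  assumes "x \<in> {0..1}"
  shows "\<bar>ln (run_weight L (aff i x)) - ln (run_weight L x)\<bar> \<le> ln 4"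
proof -
  have p: "0 < run_weight L x" "0 < run_weight L (aff i x)" by (auto simp: run_weight_pos)
  have "ln (run_weight L (aff i x)) \<le> ln (4 * run_weight L x)"
    using run_weight_aff_le[of L i x] p by simp
  moreover have "ln (run_weight L x) \<le> ln (4 * run_weight L (aff i x))"
    using run_weight_le_aff[OF assms, of L i] p by simp
  ultimately show ?thesis using p by (simp add: ln_mult)
qed

lemma log_sum_increment_le:
  assumes "x \<in> {0..1}"
  shows "\<bar>log_sum N (aff i x) - log_sum N x\<bar> \<le> ln 2"
proof -
  have "\<bar>log_sum N (aff i x) - log_sum N x\<bar>
      \<le> (\<Sum>j<N. \<bar>(1/2) ^ (j + 2) * (ln (run_weight (4 ^ j) (aff i x)) - ln (run_weight (4 ^ j) x))\<bar>)"
    unfolding log_sum_def sum_subtractf[symmetric] right_diff_distrib[symmetric] by (rule sum_abs)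
  also have "\<dots> \<le> (\<Sum>j<N. (1/2) ^ (j + 2) * ln 4)"
    using log_increment_le[OF assms] by (intro sum_mono) (simp add: abs_mult mult_left_mono)
  also have "\<dots> \<le> 1/2 * ln 4"
    unfolding sum_distrib_right[symmetric] by (intro mult_right_mono coeff_sum_le) simp
  also have "\<dots> = ln 2" using ln_realpow[of 2 2] by simp
  finally show ?thesis .
qed

text \<open>The continuous limit of the increments, and the (upper semicontinuous) limit density.\<close>

definition log_ratio :: "bool \<Rightarrow> real \<Rightarrow> real" where
  "log_ratio i x = lim (\<lambda>N. log_sum N (aff i x) - log_sum N x)"

definition dens :: "real \<Rightarrow> real" where
  "dens x = lim (\<lambda>N. exp (log_sum N x))"

lemma log_ratio_uniform:
  "uniform_limit {0..1} (\<lambda>N x. log_sum N (aff i x) - log_sum N x) (log_ratio i) sequentially"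
proof -
  have "\<bar>(log_sum (Suc N) (aff i x) - log_sum (Suc N) x) - (log_sum N (aff i x) - log_sum N x)\<bar>
      \<le> (ln 4 / 4) * (1/2) ^ N" if "x \<in> {0..1}" for N x
  proof -
    have "(log_sum (Suc N) (aff i x) - log_sum (Suc N) x) - (log_sum N (aff i x) - log_sum N x)
        = (1/2) ^ (N + 2) * (ln (run_weight (4 ^ N) (aff i x)) - ln (run_weight (4 ^ N) x))"
      by (simp add: log_sum_def algebra_simps)
    also have "\<bar>\<dots>\<bar> \<le> (1/2) ^ (N + 2) * ln 4"
      using log_increment_le[OF that] by (simp add: abs_mult mult_left_mono)
    finally show ?thesis by (simp add: power_add mult.commute)
  qed
  from uniform_limit_geometric[of "{0..1}" "\<lambda>N x. log_sum N (aff i x) - log_sum N x", OF this]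
  obtain l where l: "uniform_limit {0..1} (\<lambda>N x. log_sum N (aff i x) - log_sum N x) l sequentially"
    by auto
  then have "uniformly_convergent_on {0..1} (\<lambda>N x. log_sum N (aff i x) - log_sum N x)"
    unfolding uniformly_convergent_on_def by (intro exI[of _ l])
  then show ?thesis
    unfolding uniformly_convergent_uniform_limit_iff log_ratio_def[abs_def] .
qed

lemma log_ratio_lim: "x \<in> {0..1} \<Longrightarrow> (\<lambda>N. log_sum N (aff i x) - log_sum N x) \<longlonglongrightarrow> log_ratio i x"
  by (rule tendsto_uniform_limitI[OF log_ratio_uniform])

lemma log_ratio_cont: "continuous_on {0..1} (log_ratio i)"
proof (rule uniform_limit_theorem[OF _ log_ratio_uniform])
  have "continuous_on {0..1} (aff i)" unfolding aff_def[abs_def] by (intro continuous_intros) auto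
  then have "continuous_on {0..1} (\<lambda>x. log_sum N (aff i x))" for N
    by (rule continuous_on_compose2[OF log_sum_cont[of UNIV]]) simp
  then show "\<forall>\<^sub>F N in sequentially. continuous_on {0..1} (\<lambda>x. log_sum N (aff i x) - log_sum N x)"
    by (intro always_eventually allI continuous_intros log_sum_cont)
qed simp

lemma log_ratio_abs_le: "x \<in> {0..1} \<Longrightarrow> \<bar>log_ratio i x\<bar> \<le> ln 2"
  using log_sum_increment_le by (intro LIMSEQ_le_const2[OF tendsto_rabs[OF log_ratio_lim]]) blast+

lemma dens_lim: "(\<lambda>N. exp (log_sum N x)) \<longlonglongrightarrow> dens x"
proof -
  have "decseq (\<lambda>N. exp (log_sum N x))" by (rule decseq_SucI) (simp add: log_sum_decreasing)
  from decseq_convergent[OF this, of 0] obtain L where "(\<lambda>N. exp (log_sum N x)) \<longlonglongrightarrow> L" by auto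
  then show ?thesis unfolding dens_def using limI by metis
qed

lemma dens_le: "dens x \<le> exp (log_sum N x)"
proof -
  have "decseq (\<lambda>N. exp (log_sum N x))" by (rule decseq_SucI) (simp add: log_sum_decreasing)
  from decseq_ge[OF this dens_lim] show ?thesis .
qed

lemma dens_nonneg: "0 \<le> dens x"
  by (rule LIMSEQ_le_const[OF dens_lim]) auto

lemma dens_aff: "x \<in> {0..1} \<Longrightarrow> dens (aff i x) = exp (log_ratio i x) * dens x"
proof (rule LIMSEQ_unique[OF dens_lim])
  assume x: "x \<in> {0..1}"
  have "(\<lambda>N. exp (log_sum N (aff i x) - log_sum N x) * exp (log_sum N x)) \<longlonglongrightarrow> exp (log_ratio i x) * dens x"
    by (intro tendsto_intros log_ratio_lim x dens_lim)
  then show "(\<lambda>N. exp (log_sum N (aff i x))) \<longlonglongrightarrow> exp (log_ratio i x) * dens x"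
    by (simp add: exp_diff)
qed

lemma dens_integrable: "dens integrable_on {0..1}"
proof (rule dominated_convergence(1)[where f = "\<lambda>N x. exp (log_sum N x)" and h = "\<lambda>x. 1"])
  show "(\<lambda>x. exp (log_sum N x)) integrable_on {0..1}" for N
    by (intro integrable_continuous_real continuous_intros log_sum_cont)
qed (auto simp: log_sum_le_0 dens_lim)

lemma dens_gap:
  assumes "1/4 \<le> x" "x < 3/4"
  shows "min (1/4) (3 - 4 * x) \<le> dens x"
proof (rule LIMSEQ_le_const[OF dens_lim])
  define m where "m = min (1/4) (3 - 4 * x)"
  have m: "0 < m" "m < 1" using assms by (auto simp: m_def)
  have "m \<le> exp (log_sum N x)" for N
  proof -
    have "m \<le> run_weight L x" for L
      using run_weight_gap[of x L] assms unfolding m_def by simp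
    then have "ln m \<le> ln (run_weight L x)" for L
      using m(1) run_weight_pos[of L x] by (subst ln_le_cancel_iff)
    then have "(\<Sum>j<N. (1/2) ^ (j + 2) * ln m) \<le> log_sum N x"
      unfolding log_sum_def by (intro sum_mono mult_left_mono) simp_all
    moreover have "1 * ln m \<le> (\<Sum>j<N. (1/2) ^ (j + 2)) * ln m"
    proof (rule mult_right_mono_neg)
      show "(\<Sum>j<N. (1/2 :: real) ^ (j + 2)) \<le> 1" using coeff_sum_le[of N] by linarith
      show "ln m \<le> 0" using m by simp
    qed
    ultimately have "ln m \<le> log_sum N x" unfolding sum_distrib_right by linarith
    then have "exp (ln m) \<le> exp (log_sum N x)" by (simp only: exp_le_cancel_iff)
    then show ?thesis using m by simp
  qed
  then show "\<exists>N. \<forall>n\<ge>N. min (1/4) (3 - 4 * x) \<le> exp (log_sum n x)" unfolding m_def by blast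
qed

section \<open>A singular change of coordinates\<close>

text \<open>The distribution function of the density.\<close>

definition prim :: "real \<Rightarrow> real" where
  "prim x = integral {0..x} dens"

lemma dens_integrable': "0 \<le> x \<Longrightarrow> y \<le> 1 \<Longrightarrow> dens integrable_on {x..y}"
  by (rule integrable_on_subinterval[OF dens_integrable]) auto

lemma prim_diff:
  assumes "0 \<le> x" "x \<le> y" "y \<le> 1"
  shows "prim y - prim x = integral {x..y} dens"
  using Henstock_Kurzweil_Integration.integral_combine[OF assms(1,2) dens_integrable'[OF _ assms(3)]]
  unfolding prim_def by simp

lemma prim_mono: "0 \<le> x \<Longrightarrow> x \<le> y \<Longrightarrow> y \<le> 1 \<Longrightarrow> prim x \<le> prim y"
  using prim_diff[of x y] integral_nonneg[OF dens_integrable'[of x y]] dens_nonneg by force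

lemma prim_cont: "continuous_on {0..1} prim"
  unfolding prim_def[abs_def] by (rule indefinite_integral_continuous_1[OF dens_integrable])

lemma prim_aff_bounds:
  assumes xy: "0 \<le> x" "x \<le> y" "y \<le> 1"
    and b: "\<And>t. t \<in> {x..y} \<Longrightarrow> lo \<le> exp (log_ratio i t) / 4 \<and> exp (log_ratio i t) / 4 \<le> hi"
  shows "lo * (prim y - prim x) \<le> prim (aff i y) - prim (aff i x)"
    and "prim (aff i y) - prim (aff i x) \<le> hi * (prim y - prim x)"
proof -
  define I where "I = integral {aff i x..aff i y} dens"
  have A: "0 \<le> aff i x" "aff i x \<le> aff i y" "aff i y \<le> 1"
    using xy by (auto simp: aff_def)
  have I: "prim (aff i y) - prim (aff i x) = I" unfolding I_def by (rule prim_diff[OF A])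
  have "(dens has_integral I) (cbox (aff i x) (aff i y))"
    using dens_integrable'[OF A(1,3)] by (simp add: I_def has_integral_integral)
  from has_integral_affinity'[OF this, of "1/4" "if i then 3/4 else 0"]
  have "((\<lambda>t. dens (aff i t)) has_integral 4 * I) {x..y}"
    by (simp add: aff_def field_simps)
  then have int: "((\<lambda>t. dens (aff i t) / 4) has_integral I) {x..y}"
    using has_integral_divide[of _ "4 * I" "{x..y}" 4] by simp
  have dint: "(dens has_integral prim y - prim x) {x..y}"
    using dens_integrable'[OF xy(1,3)] by (simp add: prim_diff[OF xy] has_integral_integral)
  have eq: "dens (aff i t) / 4 = exp (log_ratio i t) / 4 * dens t" if "t \<in> {x..y}" for t
    using dens_aff[of t i] that xy by simp
  show "lo * (prim y - prim x) \<le> prim (aff i y) - prim (aff i x)"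
    unfolding I
  proof (rule has_integral_le[OF has_integral_mult_right[OF dint] int])
    show "lo * dens t \<le> dens (aff i t) / 4" if "t \<in> {x..y}" for t
      unfolding eq[OF that] using b[OF that] dens_nonneg by (intro mult_right_mono) auto
  qed
  show "prim (aff i y) - prim (aff i x) \<le> hi * (prim y - prim x)"
    unfolding I
  proof (rule has_integral_le[OF int has_integral_mult_right[OF dint]])
    show "dens (aff i t) / 4 \<le> hi * dens t" if "t \<in> {x..y}" for t
      unfolding eq[OF that] using b[OF that] dens_nonneg by (intro mult_right_mono) auto
  qed
qed

lemma exp_log_ratio_bounds:
  assumes "t \<in> {0..1}"
  shows "1/8 \<le> exp (log_ratio i t) / 4" "exp (log_ratio i t) / 4 \<le> 1/2"
proof -
  have "- ln 2 \<le> log_ratio i t" "log_ratio i t \<le> ln 2"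
    using log_ratio_abs_le[OF assms, of i] by linarith+
  then have "exp (- ln 2) \<le> exp (log_ratio i t)" "exp (log_ratio i t) \<le> exp (ln 2)"
    by (simp_all only: exp_le_cancel_iff)
  moreover have "exp (- ln 2) = (1/2 :: real)" "exp (ln 2) = (2 :: real)" by (simp_all add: exp_minus)
  ultimately show "1/8 \<le> exp (log_ratio i t) / 4" "exp (log_ratio i t) / 4 \<le> 1/2"
    by linarith+
qed

text \<open>
  The density is positive in the gap between the two images; any other interval is expanded by
  inverse branches until it meets this gap.
\<close>

lemma prim_gap:
  assumes "0 \<le> x" "x < y" "y \<le> 1" "x < 3/4" "1/4 < y"
  shows "prim x < prim y"
proof -
  define a where "a = max x (1/4)"
  define b where "b = (a + min y (3/4)) / 2"
  have ab: "x \<le> a" "0 \<le> a" "1/4 \<le> a" "a < b" "b < 3/4" "b \<le> y" "b \<le> 1"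
    using assms by (auto simp: a_def b_def)
  define m where "m = min (1/4) (3 - 4 * b)"
  have m: "0 < m" using ab by (simp add: m_def)
  have "m \<le> dens t" if "t \<in> {a..b}" for t
    using dens_gap[of t] that ab by (auto simp: m_def)
  then have "integral {a..b} (\<lambda>t. m) \<le> integral {a..b} dens"
    using ab by (intro integral_le dens_integrable') auto
  then have "m * (b - a) \<le> prim b - prim a" using ab by (simp add: prim_diff mult.commute)
  moreover have "0 < m * (b - a)" using m ab by simp
  moreover have "prim x \<le> prim a" "prim b \<le> prim y" using ab assms by (auto intro: prim_mono)
  ultimately show "prim x < prim y" by linarith
qed

lemma prim_strict_mono:
  assumes "0 \<le> x" "x < y" "y \<le> 1"
  shows "prim x < prim y"
proof -
  have "prim x < prim y" if "0 \<le> x" "x < y" "y \<le> 1" "(1/4) ^ n \<le> y - x" for n x y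
    using that
  proof (induction n arbitrary: x y)
    case (0 x y)
    then show ?case by (intro prim_gap) auto
  next
    case (Suc n x y)
    show ?case
    proof (cases "x < 3/4 \<and> 1/4 < y")
      case True
      then show ?thesis using prim_gap Suc.prems by blast
    next
      case False
      define i where "i \<longleftrightarrow> 3/4 \<le> x"
      define x' where "x' = 4 * x - (if i then 3 else 0)"
      define y' where "y' = 4 * y - (if i then 3 else 0)"
      have A: "aff i x' = x" "aff i y' = y" by (auto simp: aff_def x'_def y'_def field_simps)
      have xy': "0 \<le> x'" "x' < y'" "y' \<le> 1"
        using False Suc.prems by (auto simp: x'_def y'_def i_def)
      have "(1/4) ^ n \<le> y' - x'" using Suc.prems(4) by (simp add: x'_def y'_def)
      then have "prim x' < prim y'" using Suc.IH xy' by blast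
      moreover have "1/8 * (prim y' - prim x') \<le> prim (aff i y') - prim (aff i x')"
        using exp_log_ratio_bounds xy' by (intro prim_aff_bounds(1)[where hi = "1/2"]) auto
      moreover have "0 < 1/8 * (prim y' - prim x')" using \<open>prim x' < prim y'\<close> by simp
      ultimately show ?thesis unfolding A by linarith
    qed
  qed
  moreover obtain n where "(1/4) ^ n < y - x" using real_arch_pow_inv[of "y - x" "1/4"] assms by auto
  ultimately show ?thesis using assms less_imp_le by blast
qed

text \<open>The normalised primitive, a homeomorphism of the unit interval, and its inverse.\<close>

definition coord :: "real \<Rightarrow> real" where
  "coord x = prim x / prim 1"

definition coord_inv :: "real \<Rightarrow> real" where
  "coord_inv = inv_into {0..1} coord"

lemma prim_0: "prim 0 = 0" by (simp add: prim_def)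

lemma prim_1_pos: "0 < prim 1" using prim_strict_mono[of 0 1] by (simp add: prim_0)

lemma coord_0: "coord 0 = 0" and coord_1: "coord 1 = 1"
  using prim_1_pos by (auto simp: coord_def prim_0)

lemma coord_strict_mono: "0 \<le> x \<Longrightarrow> x < y \<Longrightarrow> y \<le> 1 \<Longrightarrow> coord x < coord y"
  unfolding coord_def using prim_1_pos by (intro divide_strict_right_mono prim_strict_mono)

lemma coord_inj: "inj_on coord {0..1}"
  by (rule linorder_inj_onI') (use coord_strict_mono in force)

lemma coord_cont: "continuous_on {0..1} coord"
  unfolding coord_def[abs_def] using prim_1_pos by (intro continuous_intros prim_cont) auto

lemma coord_image: "coord ` {0..1} = {0..1}"
proof
  show "coord ` {0..1} \<subseteq> {0..1}"
  proof (rule image_subsetI)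
    fix x :: real assume x: "x \<in> {0..1}"
    have "coord 0 \<le> coord x" using coord_strict_mono[of 0 x] x by (cases "x = 0") (auto intro: less_imp_le)
    moreover have "coord x \<le> coord 1" using coord_strict_mono[of x 1] x by (cases "x = 1") (auto intro: less_imp_le)
    ultimately show "coord x \<in> {0..1}" by (simp add: coord_0 coord_1)
  qed
  show "{0..1} \<subseteq> coord ` {0..1}"
  proof
    fix y :: real assume y: "y \<in> {0..1}"
    have "\<exists>x\<ge>0. x \<le> 1 \<and> coord x = y"
      by (rule IVT') (use y coord_0 coord_1 coord_cont in auto)
    then show "y \<in> coord ` {0..1}" by auto
  qed
qed

lemma coord_maps: "x \<in> {0..1} \<Longrightarrow> coord x \<in> {0..1}"
  using coord_image by blast

lemma coord_inv_maps: "y \<in> {0..1} \<Longrightarrow> coord_inv y \<in> {0..1}"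
  using inv_into_into[of y coord "{0..1}"] by (simp add: coord_image coord_inv_def)

lemma coord_coord_inv: "y \<in> {0..1} \<Longrightarrow> coord (coord_inv y) = y"
  using f_inv_into_f[of y coord "{0..1}"] by (simp add: coord_image coord_inv_def)

lemma coord_inv_coord: "x \<in> {0..1} \<Longrightarrow> coord_inv (coord x) = x"
  unfolding coord_inv_def by (rule inv_into_f_f[OF coord_inj])

lemma coord_inv_cont: "continuous_on {0..1} coord_inv"
  using continuous_on_inv[OF coord_cont compact_Icc, of coord_inv] coord_inv_coord coord_image by simp

section \<open>A Livsic system that is not conjugate to a pseudo-affine one\<close>

text \<open>The affine model in the new coordinate, and its derivative.\<close>

definition warped :: ifs where
  "warped i y = coord (aff i (coord_inv y))"

definition warped_deriv :: ifs where
  "warped_deriv i y = exp (log_ratio i (coord_inv y)) / 4"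

lemma warped_coord: "x \<in> {0..1} \<Longrightarrow> warped i (coord x) = coord (aff i x)"
  by (simp add: warped_def coord_inv_coord)

text \<open>
  The quotient of the increments of \<open>coord \<circ> aff i\<close> and \<open>coord\<close> is a mean value of the continuous
  function \<open>exp (log_ratio i) / 4\<close>, although neither map need be differentiable by itself.
\<close>

lemma coord_quotient:
  assumes "x \<in> {0..1}" "y \<in> {0..1}" "x \<noteq> y"
    and b: "\<And>t. t \<in> {min x y..max x y} \<Longrightarrow> lo \<le> exp (log_ratio i t) / 4 \<and> exp (log_ratio i t) / 4 \<le> hi"
  shows "(coord (aff i y) - coord (aff i x)) / (coord y - coord x) \<in> {lo..hi}"
proof -
  have *: "(coord (aff i y) - coord (aff i x)) / (coord y - coord x) \<in> {lo..hi}"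
    if xy: "0 \<le> x" "x < y" "y \<le> 1"
      and b: "\<And>t. t \<in> {x..y} \<Longrightarrow> lo \<le> exp (log_ratio i t) / 4 \<and> exp (log_ratio i t) / 4 \<le> hi" for x y
  proof -
    have "0 < prim y - prim x" using prim_strict_mono[OF xy] by simp
    moreover have "(coord (aff i y) - coord (aff i x)) / (coord y - coord x)
        = (prim (aff i y) - prim (aff i x)) / (prim y - prim x)"
      using prim_1_pos by (simp add: coord_def diff_divide_distrib[symmetric])
    ultimately show ?thesis
      using prim_aff_bounds[OF xy(1) less_imp_le[OF xy(2)] xy(3) b]
      by (simp add: pos_le_divide_eq pos_divide_le_eq)
  qed
  show ?thesis
  proof (cases "x < y")
    case True
    then show ?thesis using assms by (intro *) auto
  next
    case False
    then have "(coord (aff i x) - coord (aff i y)) / (coord x - coord y) \<in> {lo..hi}"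
      using assms by (intro *) auto
    moreover have "(coord (aff i x) - coord (aff i y)) / (coord x - coord y)
        = (coord (aff i y) - coord (aff i x)) / (coord y - coord x)"
      by (metis minus_diff_eq minus_divide_divide)
    ultimately show ?thesis by simp
  qed
qed

lemma warped_has_deriv: "deriv_on01 (warped i) (warped_deriv i)"
proof
  fix y :: real assume y: "y \<in> {0..1}"
  define x where "x = coord_inv y"
  have x: "x \<in> {0..1}" "coord x = y" using y by (auto simp: x_def coord_coord_inv simp del: atLeastAtMost_iff intro: coord_inv_maps)
  have "((\<lambda>z. (warped i z - warped i y) / (z - y)) \<longlongrightarrow> warped_deriv i y) (at y within {0..1})"
  proof (rule tendstoI)
    fix e :: real assume e: "0 < e"
    have "continuous_on {0..1} (\<lambda>t. exp (log_ratio i t) / 4)"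
      by (intro continuous_intros log_ratio_cont) auto
    then obtain d where d: "0 < d" "\<And>t. t \<in> {0..1} \<Longrightarrow> dist t x < d \<Longrightarrow>
        dist (exp (log_ratio i t) / 4) (exp (log_ratio i x) / 4) < e / 2"
      using x(1) e unfolding continuous_on_iff by (metis half_gt_zero)
    have "(coord_inv \<longlongrightarrow> x) (at y within {0..1})"
      using coord_inv_cont y unfolding continuous_on_def x_def by blast
    from tendstoD[OF this d(1)]
    show "\<forall>\<^sub>F z in at y within {0..1}. dist ((warped i z - warped i y) / (z - y)) (warped_deriv i y) < e"
      unfolding eventually_at_filter
    proof eventually_elim
      case (elim z)
      show ?case
      proof (intro impI)
        assume z: "z \<noteq> y" "z \<in> {0..1}"
        define t where "t = coord_inv z"
        have t: "t \<in> {0..1}" "coord t = z" "dist t x < d"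
          using z elim coord_inv_maps coord_coord_inv unfolding t_def by blast+
        have "(coord (aff i t) - coord (aff i x)) / (coord t - coord x)
            \<in> {exp (log_ratio i x) / 4 - e / 2..exp (log_ratio i x) / 4 + e / 2}"
        proof (rule coord_quotient[OF x(1) t(1)])
          show "x \<noteq> t" using z t x by auto
          fix s assume s: "s \<in> {min x t..max x t}"
          then have "s \<in> {0..1}" "dist s x < d" using x(1) t by (auto simp: dist_real_def)
          from d(2)[OF this]
          show "exp (log_ratio i x) / 4 - e / 2 \<le> exp (log_ratio i s) / 4 \<and>
              exp (log_ratio i s) / 4 \<le> exp (log_ratio i x) / 4 + e / 2"
            unfolding dist_real_def by linarith
        qed
        moreover have "warped i z = coord (aff i t)" "warped i y = coord (aff i x)"
          by (simp_all add: warped_def t_def x_def)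
        ultimately show "dist ((warped i z - warped i y) / (z - y)) (warped_deriv i y) < e"
          using e t(2) x(2) unfolding dist_real_def warped_deriv_def x_def[symmetric] atLeastAtMost_iff abs_less_iff
          by (auto; linarith)
      qed
    qed
  qed
  then show "(warped i has_real_derivative warped_deriv i y) (at y within {0..1})"
    by (simp add: has_field_derivative_iff)
qed

lemma warped_deriv_cont: "continuous_on {0..1} (warped_deriv i)"
  unfolding warped_deriv_def[abs_def]
  by (intro continuous_intros continuous_on_compose2[OF log_ratio_cont coord_inv_cont])
    (use coord_inv_maps in auto)

lemma warped_deriv_bounds:
  assumes "y \<in> {0..1}"
  shows "1/8 \<le> warped_deriv i y" "warped_deriv i y \<le> 1/2"
  using exp_log_ratio_bounds[OF coord_inv_maps[OF assms], of i] by (simp_all add: warped_deriv_def)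

lemma warped_maps: "y \<in> {0..1} \<Longrightarrow> warped i y \<in> {0..1}"
  unfolding warped_def by (intro coord_maps aff_maps coord_inv_maps)

interpretation warped: diff_ifs warped warped_deriv "1/2"
proof
  fix x :: real and i assume x: "x \<in> {0..1}"
  show "0 < warped_deriv i x" by (simp add: warped_deriv_def)
qed (use warped_maps warped_has_deriv warped_deriv_cont warped_deriv_bounds in auto)

lemma warped_deriv01: "y \<in> {0..1} \<Longrightarrow> deriv01 (warped i) y = warped_deriv i y"
  using warped_has_deriv by (intro deriv01_eq) blast+

lemma hyperbolic_warped: "hyperbolic_ifs 1 warped"
proof -
  have "C_class 1 (warped i)" for i
    unfolding C_class_1_iff by (rule C_int_1I[OF warped_has_deriv warped_deriv_cont])
  moreover have "warped i ` {0..1} \<subseteq> {0..1}" for i using warped_maps by blast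
  moreover have "0 < (INF t\<in>{0..1}. \<bar>deriv01 (warped i) t\<bar>)" for i
  proof -
    have "1/8 \<le> (INF t\<in>{0..1}. \<bar>deriv01 (warped i) t\<bar>)"
    proof (rule cINF_greatest)
      fix t :: real assume t: "t \<in> {0..1}"
      show "1/8 \<le> \<bar>deriv01 (warped i) t\<bar>"
        using warped_deriv01[OF t] warped_deriv_bounds[OF t, of i] by simp
    qed simp
    then show ?thesis by simp
  qed
  moreover have "(SUP t\<in>{0..1}. \<bar>deriv01 (warped i) t\<bar>) < 1" for i
  proof -
    have "(SUP t\<in>{0..1}. \<bar>deriv01 (warped i) t\<bar>) \<le> 1/2"
    proof (rule cSUP_least)
      fix t :: real assume t: "t \<in> {0..1}"
      show "\<bar>deriv01 (warped i) t\<bar> \<le> 1/2"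
        using warped_deriv01[OF t] warped_deriv_bounds[OF t, of i] by simp
    qed simp
    then show ?thesis by simp
  qed
  moreover have "warped i 0 = coord (aff i 0)" "warped i 1 = coord (aff i 1)" for i
    using warped_coord[of 0 i] warped_coord[of 1 i] by (simp_all add: coord_0 coord_1)
  ultimately show ?thesis
    unfolding hyperbolic_ifs_def
    using coord_strict_mono[of 0 "1/4"] coord_strict_mono[of "1/4" "3/4"] coord_strict_mono[of "3/4" 1]
    by (simp add: aff_def coord_0 coord_1)
qed

lemma aff_word_maps: "x \<in> {0..1} \<Longrightarrow> word_map aff w x \<in> {0..1}"
  by (induction w) (simp_all add: aff_maps del: atLeastAtMost_iff)

lemma word_map_warped: "x \<in> {0..1} \<Longrightarrow> word_map warped w (coord x) = coord (word_map aff w x)"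
  by (induction w) (simp_all add: warped_coord aff_word_maps del: atLeastAtMost_iff)

text \<open>Derivatives of words are limits of coboundaries, so that periodic points see no distortion.\<close>

lemma word_deriv_warped:
  assumes x: "x \<in> {0..1}"
  shows "(\<lambda>N. (1/4) ^ length w * exp (log_sum N (word_map aff w x) - log_sum N x))
    \<longlonglongrightarrow> word_deriv warped warped_deriv w (coord x)"
proof (induction w)
  case (Cons i w)
  let ?z = "word_map aff w x"
  have z: "?z \<in> {0..1}" by (rule aff_word_maps[OF x])
  have "(\<lambda>N. (exp (log_sum N (aff i ?z) - log_sum N ?z) / 4) *
        ((1/4) ^ length w * exp (log_sum N ?z - log_sum N x)))
      \<longlonglongrightarrow> (exp (log_ratio i ?z) / 4) * word_deriv warped warped_deriv w (coord x)"
    by (intro tendsto_intros log_ratio_lim z Cons) simp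
  moreover have "(\<lambda>N. (exp (log_sum N (aff i ?z) - log_sum N ?z) / 4) *
        ((1/4) ^ length w * exp (log_sum N ?z - log_sum N x)))
      = (\<lambda>N. (1/4) ^ length (i # w) * exp (log_sum N (word_map aff (i # w) x) - log_sum N x))"
    by (simp add: exp_diff fun_eq_iff)
  moreover have "warped_deriv i (word_map warped w (coord x)) = exp (log_ratio i ?z) / 4"
    by (simp add: word_map_warped[OF x] warped_deriv_def coord_inv_coord[OF z])
  ultimately show ?case by (simp only: word_deriv.simps)
qed simp

lemma livsic_warped: "livsic (1/4) warped"
  unfolding warped.livsic_iff
proof (intro allI impI)
  fix w :: "bool list" assume w: "w \<noteq> []"
  define y where "y = word_fix warped w"
  define x where "x = coord_inv y"
  have y: "y \<in> {0..1}" "word_map warped w y = y" using warped.word_fix[OF w] by (auto simp: y_def)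
  have x: "x \<in> {0..1}" "coord x = y" unfolding x_def
    using coord_inv_maps[OF y(1)] coord_coord_inv[OF y(1)] by blast+
  have "coord (word_map aff w x) = coord x" using word_map_warped[OF x(1), of w] x y by simp
  then have "word_map aff w x = x" using inj_onD[OF coord_inj] aff_word_maps[OF x(1)] x(1) by blast
  then have "(\<lambda>N. (1/4) ^ length w) \<longlonglongrightarrow> word_deriv warped warped_deriv w (coord x)"
    using word_deriv_warped[OF x(1), of w] by simp
  then show "word_deriv warped warped_deriv w (word_fix warped w) = (1/4) ^ length w"
    using x by (simp add: LIMSEQ_const_iff y_def)
qed

lemma word_map_aff_replicate: "word_map aff (replicate n False) x = (1/4) ^ n * x"
  by (induction n) (auto simp: aff_def)

lemma log_sum_1: "log_sum N 1 = 0"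
  by (simp add: log_sum_def run_weight_outside)

lemma word_deriv_warped_replicate:
  "word_deriv warped warped_deriv (replicate n False) 1 = (1/4) ^ n * dens ((1/4) ^ n)"
proof (rule LIMSEQ_unique)
  show "(\<lambda>N. (1/4) ^ n * exp (log_sum N ((1/4) ^ n))) \<longlonglongrightarrow> word_deriv warped warped_deriv (replicate n False) 1"
    using word_deriv_warped[of 1 "replicate n False"] by (simp add: word_map_aff_replicate coord_1 log_sum_1)
  show "(\<lambda>N. (1/4) ^ n * exp (log_sum N ((1/4) ^ n))) \<longlonglongrightarrow> (1/4) ^ n * dens ((1/4) ^ n)"
    by (intro tendsto_intros dens_lim)
qed

text \<open>
  The obstruction: \<open>dens (4\<^sup>-\<^sup>n)\<close> is the product of the relative distortions of the first map along
  the orbit \<open>1, 1/4, \<dots>, 4\<^sup>-\<^sup>n\<close>, and these products are not bounded away from \<open>0\<close>.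
\<close>

lemma dens_small:
  assumes "0 < e"
  shows "\<exists>n. dens ((1/4) ^ n) < e"
proof -
  define q where "q = exp (- (ln 2 / 4) :: real)"
  have q: "q < 1" by (simp add: q_def)
  obtain j where j: "q ^ j < e" using real_arch_pow_inv[OF assms q] by blast
  \<comment> \<open>At this \<open>n\<close> the single summand of index \<open>j\<close> is already negative enough.\<close>
  define n :: nat where "n = 4 ^ j"
  have 1: "log_sum (Suc j) ((1/4) ^ n) \<le> (1/2) ^ (j + 2) * ln (run_weight n ((1/4) ^ n))"
    using log_sum_le_0[of j "(1/4) ^ n"] unfolding log_sum_def n_def by simp
  have 2: "ln (run_weight n ((1/4) ^ n)) \<le> ln 2 - 2 * 4 ^ j * ln 2"
  proof -
    have "ln (run_weight n ((1/4) ^ n)) \<le> ln (2 * (1/4) ^ n)"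
      using run_weight_power_le[of n n] run_weight_pos[of n] by simp
    also have "\<dots> = ln 2 - real n * ln 4" by (simp add: ln_mult ln_div power_one_over ln_realpow)
    also have "ln 4 = 2 * ln (2::real)" using ln_realpow[of 2 2] by simp
    finally show ?thesis by (simp add: n_def)
  qed
  have "log_sum (Suc j) ((1/4) ^ n) \<le> (1/2) ^ (j + 2) * (ln 2 - 2 * 4 ^ j * ln 2)"
    by (rule order_trans[OF 1 mult_left_mono[OF 2]]) simp
  also have "(1/2) ^ (j + 2) * (ln 2 - 2 * 4 ^ j * ln (2::real)) = (ln 2 / 4) * ((1/2) ^ j - 2 * 2 ^ j)"
  proof -
    have "(1/2::real) ^ j * 4 ^ j = 2 ^ j" by (simp flip: power_mult_distrib)
    then show ?thesis by (simp add: power_add algebra_simps)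
  qed
  also have "\<dots> \<le> (ln 2 / 4) * (- real j)"
  proof -
    have "(1/2::real) ^ j \<le> 1" by (simp add: power_le_one)
    moreover have "1 \<le> (2::real) ^ j" by simp
    moreover have "real j \<le> 2 ^ j" by (simp add: less_imp_le)
    ultimately show ?thesis by (intro mult_left_mono) (linarith, simp)
  qed
  finally have "log_sum (Suc j) ((1/4) ^ n) \<le> (ln 2 / 4) * (- real j)" by simp
  then have "dens ((1/4) ^ n) \<le> exp ((ln 2 / 4) * (- real j))"
    using dens_le[of "(1/4) ^ n" "Suc j"] by (meson exp_le_cancel_iff order_trans)
  also have "\<dots> = q ^ j" by (simp add: q_def exp_of_nat_mult[symmetric] mult.commute)
  finally have "dens ((1/4) ^ n) < e" using j by linarith
  then show ?thesis by blast
qed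

text \<open>
  A conjugacy \<open>H\<close> would express the product of the relative distortions along the orbit of \<open>1\<close> as a
  quotient of two values of \<open>H'\<close>, which is continuous and does not vanish.
\<close>

lemma warped_not_conjugate:
  assumes pa: "pseudo_affine f" and conj: "C_conjugate 1 warped f"
  shows False
proof -
  obtain l where contr: "contractive_ifs f"
    and slope: "\<And>x i. x \<in> attractor f \<Longrightarrow> deriv01 (f i) x = l"
    using pa unfolding pseudo_affine_def pseudo_affine_slope_def by blast
  obtain c where "lipschitz_ifs f c" using contractive_lipschitz_ifs[OF contr] .
  then interpret f: lipschitz_ifs f c .
  obtain H where H: "C_diffeo 1 H" and range_eq: "range (\<lambda>i. restrict (f i) {0..1}) =
        range (\<lambda>i. restrict (H \<circ> warped i \<circ> inv_into {0..1} H) {0..1})"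
    using conj unfolding C_conjugate_def by blast
  define K where "K = inv_into {0..1} H"
  have bij: "bij_betw H {0..1} {0..1}" using H by (simp add: C_diffeo_def)
  have Hm: "H x \<in> {0..1}" if "x \<in> {0..1}" for x
    using bij that by (rule bij_betwE[THEN bspec])
  have KH: "K (H x) = x" if "x \<in> {0..1}" for x
    unfolding K_def by (rule inv_into_f_f[OF bij_betw_imp_inj_on[OF bij] that])
  define H' where "H' = deriv01 H"
  define K' where "K' = deriv01 K"
  have dH: "deriv_on01 H H'" and cH: "continuous_on {0..1} H'" and dK: "deriv_on01 K K'"
    using H unfolding C_diffeo_def C_class_1_iff C_int_1_iff H'_def K'_def K_def by blast+
  have Hnz: "H' x \<noteq> 0" if x: "x \<in> {0..1}" for x
  proof
    assume z: "H' x = 0"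
    have "deriv_on01 (\<lambda>x. K (H x)) (\<lambda>x. K' (H x) * H' x)"
      by (rule deriv_on01_comp[OF dK dH Hm])
    moreover have "deriv_on01 (\<lambda>x. K (H x)) (\<lambda>x. 1)"
      by (rule deriv_on01_cong[of "\<lambda>x. x" "\<lambda>x. 1"]) (simp_all add: KH)
    ultimately have "K' (H x) * H' x = 1"
      using deriv_on01_unique[of "\<lambda>x. K (H x)" "\<lambda>x. K' (H x) * H' x" "\<lambda>x. 1" x] x by blast
    then show False using z by simp
  qed
  have "\<exists>j. \<forall>x\<in>{0..1}. f j (H x) = H (warped i x)" for i
  proof -
    have "restrict (H \<circ> warped i \<circ> K) {0..1} \<in> range (\<lambda>i. restrict (f i) {0..1})"
      unfolding range_eq K_def by blast
    then obtain j where j: "restrict (H \<circ> warped i \<circ> K) {0..1} = restrict (f j) {0..1}" by blast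
    have "f j (H x) = H (warped i x)" if x: "x \<in> {0..1}" for x
    proof -
      have "restrict (H \<circ> warped i \<circ> K) {0..1} (H x) = restrict (f j) {0..1} (H x)" using j by simp
      then show ?thesis using Hm[OF x] KH[OF x] by simp
    qed
    then show ?thesis by blast
  qed
  then obtain \<sigma> where \<sigma>: "\<And>i x. x \<in> {0..1} \<Longrightarrow> f (\<sigma> i) (H x) = H (warped i x)" by metis
  have att_fix: "H x \<in> attractor f" if "x \<in> {0..1}" "warped i x = x" for i x
    using f.fixed_in_attractor[OF Hm[OF that(1)], of "\<sigma> i"] \<sigma>[OF that(1), of i] that(2) by simp
  have w0: "warped False 0 = 0" and w1: "warped True 1 = 1"
    using warped_coord[of 0 False] warped_coord[of 1 True] by (simp_all add: aff_def coord_0 coord_1)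
  have att_step: "H (warped i x) \<in> attractor f" if "x \<in> {0..1}" "H x \<in> attractor f" for i x
    using f.invariant_word[OF f.invariant_attractor that(2), of "[\<sigma> i]"] \<sigma>[OF that(1), of i] by simp
  have rel: "l * H' x = H' (warped i x) * warped_deriv i x"
    if x: "x \<in> {0..1}" and a: "H x \<in> attractor f" for i x
  proof -
    have "C_int 1 (f (\<sigma> i))" using contr unfolding contractive_ifs_def C_class_1_iff by blast
    then have df: "deriv_on01 (f (\<sigma> i)) (deriv01 (f (\<sigma> i)))" unfolding C_int_1_iff by blast
    have "deriv_on01 (\<lambda>x. f (\<sigma> i) (H x)) (\<lambda>x. deriv01 (f (\<sigma> i)) (H x) * H' x)"
      by (rule deriv_on01_comp[OF df dH Hm])
    moreover have "deriv_on01 (\<lambda>x. f (\<sigma> i) (H x)) (\<lambda>x. H' (warped i x) * warped_deriv i x)"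
    proof (rule deriv_on01_cong)
      show "deriv_on01 (\<lambda>x. H (warped i x)) (\<lambda>x. H' (warped i x) * warped_deriv i x)"
        by (rule deriv_on01_comp[OF dH warped_has_deriv]) (rule warped_maps)
    qed (rule \<sigma>[symmetric], assumption, rule refl)
    ultimately have "deriv01 (f (\<sigma> i)) (H x) * H' x = H' (warped i x) * warped_deriv i x"
      using deriv_on01_unique[of "\<lambda>x. f (\<sigma> i) (H x)" "\<lambda>x. deriv01 (f (\<sigma> i)) (H x) * H' x"
          "\<lambda>x. H' (warped i x) * warped_deriv i x" x] x by blast
    then show ?thesis using slope[OF a] by simp
  qed
  have l: "l = 1/4"
  proof -
    have "H 0 \<in> attractor f" using att_fix[of 0 False] w0 by simp
    from rel[OF _ this, of False] have "l = warped_deriv False 0" using Hnz[of 0] w0 by simp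
    moreover have "word_fix warped [False] = 0" by (rule warped.word_fix_eqI) (auto simp: w0)
    then have "warped_deriv False 0 = 1/4"
      using livsic_warped[unfolded warped.livsic_iff, rule_format, of "[False]"] by simp
    ultimately show ?thesis by simp
  qed
  have orbit: "H (word_map warped (replicate n False) 1) \<in> attractor f \<and>
      H' (word_map warped (replicate n False) 1) * word_deriv warped warped_deriv (replicate n False) 1
        = (1/4) ^ n * H' 1" for n
  proof (induction n)
    case 0
    show ?case using att_fix[of 1 True] w1 by simp
  next
    case (Suc n)
    let ?z = "word_map warped (replicate n False) 1"
    have z: "?z \<in> {0..1}" by (rule warped.word_maps) simp
    have "H' (warped False ?z) * warped_deriv False ?z = 1/4 * H' ?z"
      using rel[OF z, of False] Suc l by simp
    then have "H' (warped False ?z) * (warped_deriv False ?z * word_deriv warped warped_deriv (replicate n False) 1)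
        = 1/4 * (H' ?z * word_deriv warped warped_deriv (replicate n False) 1)"
      by (metis mult.assoc)
    then show ?case using Suc att_step[OF z] by simp
  qed
  obtain B where B: "0 < B" "\<And>x. x \<in> {0..1} \<Longrightarrow> \<bar>H' x\<bar> \<le> B" using bounded_on01[OF cH] by metis
  obtain n where n: "dens ((1/4) ^ n) < \<bar>H' 1\<bar> / B"
    using dens_small[of "\<bar>H' 1\<bar> / B"] B Hnz[of 1] by auto
  define z where "z = word_map warped (replicate n False) 1"
  have z: "z \<in> {0..1}" unfolding z_def by (rule warped.word_maps) simp
  have "H' z * ((1/4) ^ n * dens ((1/4) ^ n)) = (1/4) ^ n * H' 1"
    using orbit[of n] unfolding z_def word_deriv_warped_replicate by blast
  then have "H' 1 = H' z * dens ((1/4) ^ n)" by simp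
  then have "\<bar>H' 1\<bar> = \<bar>H' z\<bar> * dens ((1/4) ^ n)" using dens_nonneg by (simp add: abs_mult)
  also have "\<dots> \<le> B * dens ((1/4) ^ n)" using B(2)[OF z] dens_nonneg by (intro mult_right_mono)
  also have "\<dots> < B * (\<bar>H' 1\<bar> / B)" using n B(1) by (intro mult_strict_left_mono)
  also have "\<dots> = \<bar>H' 1\<bar>" using B(1) by simp
  finally show False by simp
qed

section \<open>The dichotomy between \<open>s = 1\<close> and \<open>s > 1\<close>\<close>

theorem theorem5:
  shows "(\<exists>g l. hyperbolic_ifs 1 g \<and> 0 < l \<and> l < 1/2 \<and> livsic l g \<and>
            \<not> (\<exists>f. pseudo_affine f \<and> C_conjugate 1 g f)) \<and>
         (\<forall>s g l. 1 < s \<longrightarrow> hyperbolic_ifs s g \<longrightarrow> 0 < l \<longrightarrow> l < 1/2 \<longrightarrow> livsic l g \<longrightarrow>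
            (\<exists>f. pseudo_affine_slope l f \<and> (\<forall>i. C_class s (f i)) \<and> C_conjugate s g f))"
proof (intro conjI allI impI)
  show "\<exists>g l. hyperbolic_ifs 1 g \<and> 0 < l \<and> l < 1/2 \<and> livsic l g \<and>
      \<not> (\<exists>f. pseudo_affine f \<and> C_conjugate 1 g f)"
  proof (intro exI conjI)
    show "hyperbolic_ifs 1 warped" by (rule hyperbolic_warped)
    show "livsic (1/4) warped" by (rule livsic_warped)
    show "\<not> (\<exists>f. pseudo_affine f \<and> C_conjugate 1 warped f)" using warped_not_conjugate by blast
  qed simp_all
next
  fix s g l
  assume "1 < s" "hyperbolic_ifs s g" "0 < l" "l < 1/2" "livsic l g"
  then show "\<exists>f. pseudo_affine_slope l f \<and> (\<forall>i. C_class s (f i)) \<and> C_conjugate s g f"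
    by (rule livsic_imp_pseudo_affine)
qed

end
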